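(* Let $G=\langle h_1,\dots,h_m\rangle\in\mathcal G_{dis}$ be a polynomial semigroup with $m\ge3$. Suppose that there exists an element $J_0\in\hat{\mathcal J}_G$ such that $\bigcup_{j=1}^{m-1}J(h_j)\subset J_0$, and such that for each $j=1,\dots,m-1$ we have $h_j^{-1}(J(h_m))\cap J_0\ne\emptyset$. Then all of the following hold. 1. $\sharp(\hat{\mathcal J}_G)=\aleph_0$. 2. $J_0=J_{\min}$ or $J_0=J_{\max}$. 3. If $J_0=J_{\min}$, then $J_{\max}=J(h_m)$, $J(G)=J_{\max}\cup\bigcup_{n\in\mathbb N\cup\{0\}}(h_m)^{-n}(J_{\min})$, and for any $J\in\hat{\mathcal J}_G$ with $J\ne J_{\max}$, there exists no sequence $\{C_j\}_{j\in\mathbb N}$ of mutually distinct elements of $\hat{\mathcal J}_G$ such that $\min_{z\in C_j}d(z,J)\to0$ as $j\to\infty$. 4. If $J_0=J_{\max}$, then $J_{\min}=J(h_m)$, $J(G)=J_{\min}\cup\bigcup_{n\in\mathbb N\cup\{0\}}(h_m)^{-n}(J_{\max})$, and for any $J\in\hat{\mathcal J}_G$ with $J\ne J_{\min}$, there exists no sequence $\{C_j\}_{j\in\mathbb N}$ of mutually distinct elements of $\hat{\mathcal J}_G$ such that $\min_{z\in C_j}d(z,J)\to0$ as $j\to\infty$.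
   Context: $\hat{\mathbb C}$ is the Riemann sphere and $d$ the spherical distance, with $d(z,J)=\inf_{w\in J}d(z,w)$. A polynomial semigroup is a semigroup (under composition) generated by a family of non-constant polynomial maps on $\hat{\mathbb C}$; $\langle h_1,\dots,h_m\rangle$ is the semigroup generated by $h_1,\dots,h_m$. The Fatou set $F(G)$ is the set of $z\in\hat{\mathbb C}$ having a neighborhood on which $G$ is a normal family; the Julia set is $J(G)=\hat{\mathbb C}\setminus F(G)$; $J(g)$ is the Julia set of the semigroup generated by $g$. $P(G)=\overline{\bigcup_{g\in G}\{\text{critical values of } g:\hat{\mathbb C}\to\hat{\mathbb C}\}}$ and $P^{*}(G)=P(G)\setminus\{\infty\}$. $\mathcal G$ is the set of polynomial semigroups $G$ all of whose elements have degree at least two and for which $P^{*}(G)$ is bounded in $\mathbb C$; $\mathcal G_{dis}=\{G\in\mathcal G:J(G)\text{ disconnected}\}$. $\hat{\mathcal J}_G$ is the set of all connected components of $J(G)$ and $\mathcal J_G$ the set of those contained in $\mathbb C$. For connected sets $K_1,K_2\subset\mathbb C$, $K_1\le K_2$ means $K_1=K_2$ or $K_1$ is contained in a bounded component of $\mathbb C\setminus K_2$. For $G\in\mathcal G_{dis}$, $J_{\min}=J_{\min}(G)$ and $J_{\max}=J_{\max}(G)$ denote the unique elements of $\mathcal J_G$ with $J_{\min}\le J\le J_{\max}$ for all $J\in\mathcal J_G$ (they exist). *)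

theory Defs
  imports "HOL-Analysis.Analysis" "HOL-Computational_Algebra.Polynomial"
begin

datatype riemann_sphere = Fin (fin_part: complex) | Infty

text \<open>Inverse stereographic projection onto the unit sphere of \<open>\<complex> \<times> \<real>\<close>.\<close>

fun stereo :: "riemann_sphere \<Rightarrow> complex \<times> real" where
  "stereo (Fin z) =
     (complex_of_real (2 / (1 + (norm z)\<^sup>2)) * z, ((norm z)\<^sup>2 - 1) / ((norm z)\<^sup>2 + 1))"
| "stereo Infty = (0, 1)"

lemma stereo_norm: "inner (stereo a) (stereo a) = 1"
proof (cases a)
  case (Fin z)
  let ?t = "(norm z)\<^sup>2"
  have p: "1 + ?t \<noteq> 0" "?t + 1 \<noteq> 0"
    by (smt (verit) zero_le_power2)+
  have "norm (complex_of_real (2 / (1 + ?t)) * z) = 2 / (1 + ?t) * norm z"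
    by (simp only: norm_mult norm_of_real) simp
  hence "inner (stereo a) (stereo a) = (2 / (1 + ?t))\<^sup>2 * ?t + ((?t - 1) / (?t + 1))\<^sup>2"
    unfolding Fin stereo.simps inner_Pair
    by (simp only: dot_square_norm power_mult_distrib real_norm_def power2_abs)
  also have "\<dots> = (4 * ?t + (?t - 1)\<^sup>2) / (1 + ?t)\<^sup>2"
    by (simp add: power_divide add_divide_distrib add.commute)
  also have "4 * ?t + (?t - 1)\<^sup>2 = (1 + ?t)\<^sup>2"
    by (simp add: power2_eq_square algebra_simps)
  finally show ?thesis
    using p by simp
qed simp

lemma stereo_inj: "stereo a = stereo b \<Longrightarrow> a = b"
proof (induction a)
  case (Fin z)
  have pos: "1 + (norm u)\<^sup>2 > 0" for u :: complex
    by (smt (verit) zero_le_power2)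
  show ?case
  proof (cases b)
    case (Fin w)
    have "((norm z)\<^sup>2 - 1) * ((norm w)\<^sup>2 + 1) = ((norm w)\<^sup>2 - 1) * ((norm z)\<^sup>2 + 1)"
      using Fin.prems Fin pos[of z] pos[of w] by (simp add: frac_eq_eq)
    hence e: "(norm z)\<^sup>2 = (norm w)\<^sup>2"
      by (simp add: algebra_simps)
    have "complex_of_real (2 / (1 + (norm z)\<^sup>2)) * z = complex_of_real (2 / (1 + (norm z)\<^sup>2)) * w"
      using Fin.prems Fin e by simp
    moreover have "complex_of_real (2 / (1 + (norm z)\<^sup>2)) \<noteq> 0"
      using pos[of z] by (simp only: of_real_eq_0_iff) simp
    ultimately show ?thesis
      using Fin by (metis mult_left_cancel)
  next
    case Infty
    then show ?thesis
      using Fin.prems pos[of z] by (simp add: divide_eq_eq split: if_splits)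
  qed
next
  case Infty
  have pos: "1 + (norm u)\<^sup>2 > 0" for u :: complex
    by (smt (verit) zero_le_power2)
  show ?case
  proof (cases b)
    case (Fin w)
    then show ?thesis
      using Infty.prems pos[of w] by (simp add: eq_divide_eq split: if_splits)
  qed simp
qed

lemma stereo_inner_bounds: "- 1 \<le> inner (stereo a) (stereo b)" "inner (stereo a) (stereo b) \<le> 1"
  using Cauchy_Schwarz_ineq2[of "stereo a" "stereo b"]
  by (simp_all add: norm_eq_sqrt_inner stereo_norm abs_le_iff)

lemma arccos_inner_triangle:
  fixes u v w :: "'a::real_inner"
  assumes u: "inner u u = 1" and v: "inner v v = 1" and w: "inner w w = 1"
  shows "arccos (inner u w) \<le> arccos (inner u v) + arccos (inner v w)"
proof -
  have bd: "\<bar>inner x y\<bar> \<le> 1" if "inner x x = 1" "inner y y = 1" for x y :: 'a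
    using Cauchy_Schwarz_ineq2[of x y] that by (simp add: norm_eq_sqrt_inner)
  note b = bd[OF u v] bd[OF v w] bd[OF u w]
  define p where "p = inner u v"
  define q where "q = inner v w"
  define u' where "u' = u - p *\<^sub>R v"
  define w' where "w' = w - q *\<^sub>R v"
  have nu: "norm u' = sqrt (1 - p\<^sup>2)"
    unfolding norm_eq_sqrt_inner
    by (simp add: u'_def p_def inner_diff u v inner_commute power2_eq_square algebra_simps)
  have nw: "norm w' = sqrt (1 - q\<^sup>2)"
    unfolding norm_eq_sqrt_inner
    by (simp add: w'_def q_def inner_diff w v inner_commute power2_eq_square algebra_simps)
  have "inner u w = p * q + inner u' w'"
    by (simp add: u'_def w'_def p_def q_def inner_diff v inner_commute algebra_simps)
  moreover have "\<bar>inner u' w'\<bar> \<le> sqrt (1 - p\<^sup>2) * sqrt (1 - q\<^sup>2)"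
    using Cauchy_Schwarz_ineq2[of u' w'] by (simp add: nu nw)
  ultimately have key: "p * q - sqrt (1 - p\<^sup>2) * sqrt (1 - q\<^sup>2) \<le> inner u w"
    by linarith
  have pq: "- 1 \<le> p" "p \<le> 1" "- 1 \<le> q" "q \<le> 1"
    using b by (simp_all add: p_def q_def abs_le_iff)
  have c: "cos (arccos p + arccos q) \<le> inner u w"
    using key pq by (simp add: cos_add sin_arccos_abs abs_le_iff cos_arccos)
  have r: "- 1 \<le> inner u w" "inner u w \<le> 1"
    using b by (simp_all add: abs_le_iff)
  have nn: "0 \<le> arccos p" "0 \<le> arccos q"
    using pq arccos_bounded by auto
  show ?thesis
  proof (cases "arccos p + arccos q \<le> pi")
    case True
    have "arccos (inner u w) \<le> arccos (cos (arccos p + arccos q))"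
      using c r by (intro arccos_le_arccos) auto
    also have "\<dots> = arccos p + arccos q"
      using True nn by (intro arccos_cos) auto
    finally show ?thesis
      by (simp add: p_def q_def)
  next
    case False
    moreover have "arccos (inner u w) \<le> pi"
      using r arccos_bounded by blast
    ultimately show ?thesis
      by (simp add: p_def q_def)
  qed
qed

instantiation riemann_sphere :: metric_space
begin

text \<open>Great-circle distance between the corresponding points of the unit sphere.\<close>

definition dist_riemann_sphere :: "riemann_sphere \<Rightarrow> riemann_sphere \<Rightarrow> real" where
  "dist_riemann_sphere a b = arccos (inner (stereo a) (stereo b))"

definition uniformity_riemann_sphere :: "(riemann_sphere \<times> riemann_sphere) filter" where
  "uniformity_riemann_sphere = (INF e\<in>{0<..}. principal {(x, y). dist x y < e})"

definition open_riemann_sphere :: "riemann_sphere set \<Rightarrow> bool" where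
  "open_riemann_sphere U \<longleftrightarrow>
     (\<forall>x\<in>U. eventually (\<lambda>(x', y). x' = x \<longrightarrow> y \<in> U) uniformity)"

instance
proof
  fix a b c :: riemann_sphere
  show "dist a b = 0 \<longleftrightarrow> a = b"
  proof
    assume "dist a b = 0"
    hence "cos (arccos (inner (stereo a) (stereo b))) = 1"
      by (simp add: dist_riemann_sphere_def)
    hence "inner (stereo a) (stereo b) = 1"
      by (simp add: cos_arccos stereo_inner_bounds)
    hence "inner (stereo a - stereo b) (stereo a - stereo b) = 0"
      by (simp add: inner_diff stereo_norm inner_commute)
    thus "a = b"
      by (simp add: stereo_inj)
  qed (simp add: dist_riemann_sphere_def stereo_norm)
  show "dist a b \<le> dist a c + dist b c"
    using arccos_inner_triangle[OF stereo_norm[of a] stereo_norm[of c] stereo_norm[of b]]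
    by (simp add: dist_riemann_sphere_def inner_commute)
qed (simp_all add: uniformity_riemann_sphere_def open_riemann_sphere_def)

end

fun sphere_poly :: "complex poly \<Rightarrow> riemann_sphere \<Rightarrow> riemann_sphere" where
  "sphere_poly p (Fin z) = Fin (poly p z)"
| "sphere_poly p Infty = Infty"

definition polynomial_map :: "(riemann_sphere \<Rightarrow> riemann_sphere) \<Rightarrow> bool" where
  "polynomial_map g \<longleftrightarrow> (\<exists>p. degree p \<ge> 1 \<and> g = sphere_poly p)"

inductive_set semigroup_generated :: "('a \<Rightarrow> 'a) set \<Rightarrow> ('a \<Rightarrow> 'a) set" for H where
  gen: "h \<in> H \<Longrightarrow> h \<in> semigroup_generated H"
| comp: "f \<in> semigroup_generated H \<Longrightarrow> g \<in> semigroup_generated H \<Longrightarrow>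
    f \<circ> g \<in> semigroup_generated H"

definition polynomial_semigroup :: "(riemann_sphere \<Rightarrow> riemann_sphere) set \<Rightarrow> bool" where
  "polynomial_semigroup G \<longleftrightarrow>
     (\<exists>H. H \<noteq> {} \<and> (\<forall>h\<in>H. polynomial_map h) \<and> G = semigroup_generated H)"

definition normal_on :: "(riemann_sphere \<Rightarrow> riemann_sphere) set \<Rightarrow> riemann_sphere set \<Rightarrow> bool" where
  "normal_on \<F> U \<longleftrightarrow>
     (\<forall>f :: nat \<Rightarrow> riemann_sphere \<Rightarrow> riemann_sphere. range f \<subseteq> \<F> \<longrightarrow>
       (\<exists>r l. strict_mono (r :: nat \<Rightarrow> nat) \<and>
         (\<forall>K. compact K \<and> K \<subseteq> U \<longrightarrow> uniform_limit K (\<lambda>n. f (r n)) l sequentially)))"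

definition fatou_set :: "(riemann_sphere \<Rightarrow> riemann_sphere) set \<Rightarrow> riemann_sphere set" where
  "fatou_set G = {z. \<exists>U. open U \<and> z \<in> U \<and> normal_on G U}"

definition julia_set :: "(riemann_sphere \<Rightarrow> riemann_sphere) set \<Rightarrow> riemann_sphere set" where
  "julia_set G = - fatou_set G"

abbreviation julia :: "(riemann_sphere \<Rightarrow> riemann_sphere) \<Rightarrow> riemann_sphere set" where
  "julia g \<equiv> julia_set (semigroup_generated {g})"

fun sphere_inv :: "riemann_sphere \<Rightarrow> riemann_sphere" where
  "sphere_inv (Fin z) = (if z = 0 then Infty else Fin (inverse z))"
| "sphere_inv Infty = Fin 0"

text \<open>A critical point of a holomorphic self-map of the sphere is a zero of its derivative,
  computed in the charts \<open>z\<close> (near finite points) and \<open>1/z\<close> (near infinity) of the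
  source and the target.\<close>

definition critical_at_finite :: "(riemann_sphere \<Rightarrow> riemann_sphere) \<Rightarrow> complex \<Rightarrow> bool" where
  "critical_at_finite g z \<longleftrightarrow>
     (if g (Fin z) \<noteq> Infty then deriv (\<lambda>w. fin_part (g (Fin w))) z = 0
      else deriv (\<lambda>w. fin_part (sphere_inv (g (Fin w)))) z = 0)"

fun critical_point :: "(riemann_sphere \<Rightarrow> riemann_sphere) \<Rightarrow> riemann_sphere \<Rightarrow> bool" where
  "critical_point g (Fin z) \<longleftrightarrow> critical_at_finite g z"
| "critical_point g Infty \<longleftrightarrow> critical_at_finite (g \<circ> sphere_inv) 0"

definition critical_values :: "(riemann_sphere \<Rightarrow> riemann_sphere) \<Rightarrow> riemann_sphere set" where
  "critical_values g = g ` {c. critical_point g c}"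

definition postcritical_set :: "(riemann_sphere \<Rightarrow> riemann_sphere) set \<Rightarrow> riemann_sphere set" where
  "postcritical_set G = closure (\<Union>g\<in>G. critical_values g)"

definition planar_postcritical_set :: "(riemann_sphere \<Rightarrow> riemann_sphere) set \<Rightarrow> complex set" where
  "planar_postcritical_set G = {z. Fin z \<in> postcritical_set G - {Infty}}"

text \<open>``pcb'' abbreviates ``postcritically bounded (in the plane)''.\<close>

definition pcb_semigroups :: "(riemann_sphere \<Rightarrow> riemann_sphere) set set" where
  "pcb_semigroups = {G. polynomial_semigroup G \<and>
     (\<forall>g\<in>G. \<exists>p. degree p \<ge> 2 \<and> g = sphere_poly p) \<and>
     bounded (planar_postcritical_set G)}"

definition pcb_dis_semigroups :: "(riemann_sphere \<Rightarrow> riemann_sphere) set set" where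
  "pcb_dis_semigroups = {G \<in> pcb_semigroups. \<not> connected (julia_set G)}"

abbreviation julia_components ::
  "(riemann_sphere \<Rightarrow> riemann_sphere) set \<Rightarrow> riemann_sphere set set" where
  "julia_components G \<equiv> components (julia_set G)"

definition planar_julia_components ::
  "(riemann_sphere \<Rightarrow> riemann_sphere) set \<Rightarrow> riemann_sphere set set" where
  "planar_julia_components G = {J \<in> julia_components G. J \<subseteq> range Fin}"

definition surrounded_by :: "complex set \<Rightarrow> complex set \<Rightarrow> bool" (infix "\<preceq>\<^sub>s" 50) where
  "K\<^sub>1 \<preceq>\<^sub>s K\<^sub>2 \<longleftrightarrow> K\<^sub>1 = K\<^sub>2 \<or> (\<exists>U \<in> components (- K\<^sub>2). bounded U \<and> K\<^sub>1 \<subseteq> U)"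

text \<open>The order lives on subsets of \<open>\<complex>\<close>, while components of the Julia set are kept as
  subsets of the sphere; hence the preimages under \<open>Fin\<close>. The least and greatest components
  are only meaningful for \<open>G \<in> pcb_dis_semigroups\<close>.\<close>

definition J_min :: "(riemann_sphere \<Rightarrow> riemann_sphere) set \<Rightarrow> riemann_sphere set" where
  "J_min G = (THE K. K \<in> planar_julia_components G \<and>
     (\<forall>J \<in> planar_julia_components G. Fin -` K \<preceq>\<^sub>s Fin -` J))"

definition J_max :: "(riemann_sphere \<Rightarrow> riemann_sphere) set \<Rightarrow> riemann_sphere set" where
  "J_max G = (THE K. K \<in> planar_julia_components G \<and>
     (\<forall>J \<in> planar_julia_components G. Fin -` J \<preceq>\<^sub>s Fin -` K))"

text \<open>The mutually distinct components \<open>C j\<close> accumulate at \<open>J\<close> in the sense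
  \<open>min\<^bsub>z \<in> C j\<^esub> d(z, J) \<longlonglongrightarrow> 0\<close>; the minimum is an infimum of a continuous
  function over a nonempty compact set.\<close>

definition components_accumulate_at ::
  "(riemann_sphere \<Rightarrow> riemann_sphere) set \<Rightarrow> riemann_sphere set \<Rightarrow> bool" where
  "components_accumulate_at G J \<longleftrightarrow>
     (\<exists>C :: nat \<Rightarrow> riemann_sphere set. range C \<subseteq> julia_components G \<and> inj C \<and>
       (\<lambda>j. INF z\<in>C j. infdist z J) \<longlonglongrightarrow> 0)"

end

theory Submission
  imports Defs "HOL-Complex_Analysis.Great_Picard"
    "HOL-Computational_Algebra.Fundamental_Theorem_Algebra"
begin

text \<open>Write \<open>q\<close> for \<open>h m\<close>, \<open>K\<close> for its filled Julia set and \<open>A n = q\<^sup>-\<^sup>n(J\<^sub>0)\<close>. Since all finite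
  critical values of the semigroup are bounded, \<open>g\<^sup>-\<^sup>1(K)\<close> is a full continuum for every element \<open>g\<close>,
  so \<open>g\<^sup>-\<^sup>1(J(q))\<close> is connected and surrounds every critical value of the semigroup; in particular
  \<open>h\<^sub>j\<^sup>-\<^sup>1(J(q)) \<subseteq> J\<^sub>0\<close> for \<open>j < m\<close>. Confluence of polynomial maps gives \<open>h\<^sub>j\<^sup>-\<^sup>1(J\<^sub>0) \<subseteq> J\<^sub>0\<close> and makes
  each \<open>A n\<close> connected.
  A closed backward invariant set with two points contains the Julia set (Montel), so \<open>J\<^sub>0\<close> misses
  \<open>J(q)\<close> and the \<open>A n\<close> are disjoint; having a common surrounded point, they are linearly nested between
  \<open>J\<^sub>0\<close> and \<open>J(q)\<close>, and by normality of the iterates of \<open>q\<close> they accumulate only at \<open>J(q)\<close>. For \<open>j < m\<close> the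
  set \<open>h\<^sub>j\<^sup>-\<^sup>1(A n)\<close> is squeezed between two subsets of \<open>J\<^sub>0\<close>, hence lies in \<open>J\<^sub>0\<close>. Thus
  \<open>J(q) \<union> (\<Union>n. A n)\<close> is closed and backward invariant, so it is the Julia set of the semigroup, and its
  components are \<open>J(q)\<close> and the relatively open sets \<open>A n\<close>.\<close>

subsection \<open>Topology of the sphere\<close>

text \<open>The obstacle is that preimages under the other generators could a priori create Julia
  components beyond the sets \<open>A n\<close>. Order relations between plane continua exclude
  this. They rest on two facts: disjoint continua are nested as soon as some point lies in the
  exterior of neither, and both exterior and inside commute with polynomial preimages. The direction
  of the nesting is dictated by \<open>Jm\<close>, the planar Julia set of the last generator: with
  \<open>J\<^sub>0\<close> and \<open>A 1\<close> in the wrong order, the filled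
  \<open>J\<^sub>0\<close> would be backward or forward invariant, which contradicts the position of
  \<open>Jm\<close>. The topology is done in the plane; the sphere enters through normality and
  through a neighbourhood of \<open>Infty\<close> on which the semigroup is normal. Two points
  suffice in the Montel argument because polynomials omit \<open>Infty\<close> on the plane. That
  the Julia set of a generator has two points rests on its degree being at least two. Connectedness
  of the preimages comes from lemniscates at levels above all critical values.\<close>

lemma inner_stereo: "inner (stereo a) (stereo b) = 1 - (norm (stereo a - stereo b))\<^sup>2 / 2"
  by (simp add: power2_norm_eq_inner inner_diff stereo_norm inner_commute field_simps)

text \<open>\<open>cos\<close> and \<open>arccos\<close> pass between great-circle distance and
  inner product, and for unit vectors the inner product determines the chordal distance. Hence
  convergence on the sphere can be checked in Euclidean coordinates.\<close>

lemma tendsto_sphere_iff: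
  "(f \<longlongrightarrow> a) F \<longleftrightarrow> ((\<lambda>x. stereo (f x)) \<longlongrightarrow> stereo a) F"
proof
  assume "(f \<longlongrightarrow> a) F"
  hence "((\<lambda>x. cos (dist (f x) a)) \<longlongrightarrow> cos 0) F"
    unfolding tendsto_dist_iff[of f] by (rule isCont_tendsto_compose[OF isCont_cos])
  hence "((\<lambda>x. inner (stereo (f x)) (stereo a)) \<longlongrightarrow> 1) F"
    by (simp add: dist_riemann_sphere_def cos_arccos stereo_inner_bounds)
  hence "((\<lambda>x. sqrt (2 - 2 * inner (stereo (f x)) (stereo a))) \<longlongrightarrow> sqrt (2 - 2 * 1)) F"
    by (intro tendsto_intros)
  thus "((\<lambda>x. stereo (f x)) \<longlongrightarrow> stereo a) F"
    by (subst tendsto_dist_iff) (simp add: inner_stereo dist_norm)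
next
  assume "((\<lambda>x. stereo (f x)) \<longlongrightarrow> stereo a) F"
  hence "((\<lambda>x. inner (stereo (f x)) (stereo a)) \<longlongrightarrow> inner (stereo a) (stereo a)) F"
    by (intro tendsto_intros)
  hence "((\<lambda>x. arccos (inner (stereo (f x)) (stereo a))) \<longlongrightarrow> arccos 1) F"
    unfolding stereo_norm
    by (rule continuous_on_tendsto_compose[OF continuous_on_arccos'])
       (auto simp: stereo_inner_bounds)
  thus "(f \<longlongrightarrow> a) F"
    by (subst tendsto_dist_iff) (simp add: dist_riemann_sphere_def)
qed

lemma tendsto_Fin: assumes "(f \<longlongrightarrow> a) F" shows "((\<lambda>x. Fin (f x)) \<longlongrightarrow> Fin a) F"
proof -
  have "1 + (norm z)\<^sup>2 \<noteq> 0" "(norm z)\<^sup>2 + 1 \<noteq> 0" for z :: complex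
    by (smt (verit) zero_le_power2)+
  thus ?thesis
    unfolding tendsto_sphere_iff stereo.simps
    by (intro tendsto_intros assms) auto
qed

lemma continuous_on_Fin [continuous_intros]:
  "continuous_on S f \<Longrightarrow> continuous_on S (\<lambda>x. Fin (f x))"
  unfolding continuous_on_def by (auto intro: tendsto_Fin)

text \<open>The inner product of \<open>stereo (Fin z)\<close> with the north pole is
  \<open>1 - 2 / (1 + |z|^2)\<close>, which tends to \<open>1\<close>.\<close>

lemma tendsto_Fin_Infty:
  assumes "filterlim f at_infinity F" shows "((\<lambda>x. Fin (f x)) \<longlongrightarrow> Infty) F"
proof -
  have "filterlim (\<lambda>x. norm (f x)) at_top F"
    using assms filterlim_at_infinity_imp_norm_at_top by blast
  hence "filterlim (\<lambda>x. (norm (f x))\<^sup>2) at_top F"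
    by (rule filterlim_pow_at_top[rotated]) simp
  hence "filterlim (\<lambda>x. 1 + (norm (f x))\<^sup>2) at_top F"
    by (rule filterlim_tendsto_add_at_top[OF tendsto_const])
  hence "((\<lambda>x. 2 / (1 + (norm (f x))\<^sup>2)) \<longlongrightarrow> 0) F"
    by (intro tendsto_divide_0[OF tendsto_const] filterlim_at_top_imp_at_infinity)
  hence "((\<lambda>x. 1 - 2 / (1 + (norm (f x))\<^sup>2)) \<longlongrightarrow> 1 - 0) F"
    by (intro tendsto_intros)
  moreover have "inner (stereo (Fin z)) (stereo Infty) = 1 - 2 / (1 + (norm z)\<^sup>2)" for z
  proof -
    have "1 + (norm z)\<^sup>2 \<noteq> 0" by (smt (verit) zero_le_power2)
    thus ?thesis by (simp add: inner_Pair field_simps)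
  qed
  ultimately have "((\<lambda>x. inner (stereo (Fin (f x))) (stereo Infty)) \<longlongrightarrow> 1) F"
    by simp
  hence "((\<lambda>x. arccos (inner (stereo (Fin (f x))) (stereo Infty))) \<longlongrightarrow> arccos 1) F"
    by (rule continuous_on_tendsto_compose[OF continuous_on_arccos'])
       (auto simp: stereo_inner_bounds simp del: stereo.simps)
  thus ?thesis
    by (subst tendsto_dist_iff) (simp add: dist_riemann_sphere_def)
qed

lemma range_Fin: "range Fin = - {Infty}"
  by (auto simp: image_iff) (metis riemann_sphere.exhaust)

lemma inj_Fin: "inj Fin"
  by (auto simp: inj_on_def)

lemma continuous_on_stereo: "continuous_on S stereo"
  unfolding continuous_on_def using tendsto_sphere_iff[of "\<lambda>x. x"] by auto

text \<open>Projection from the north pole recovers a finite point as the first coordinate divided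
  by one minus the height. This makes \<open>Fin\<close> an open embedding, so topology moves freely
  between plane and sphere.\<close>

lemma continuous_on_fin_part: "continuous_on (range Fin) fin_part"
proof -
  have eq: "fin_part x = (1 / (1 - snd (stereo x))) *\<^sub>R fst (stereo x)"
    and ne: "1 - snd (stereo x) \<noteq> 0" if "x \<in> range Fin" for x
  proof -
    from that obtain z where x: "x = Fin z" by (rule rangeE)
    have p: "1 + (norm z)\<^sup>2 > 0" by (smt (verit) zero_le_power2)
    hence s: "1 - snd (stereo x) = 2 / (1 + (norm z)\<^sup>2)" by (simp add: x field_simps)
    show "fin_part x = (1 / (1 - snd (stereo x))) *\<^sub>R fst (stereo x)"
      unfolding s using p by (simp add: x scaleR_conv_of_real field_simps flip: of_real_mult of_real_add of_real_power of_real_divide)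
    show "1 - snd (stereo x) \<noteq> 0" unfolding s using p by simp
  qed
  have "continuous_on (range Fin) (\<lambda>x. (1 / (1 - snd (stereo x))) *\<^sub>R fst (stereo x))"
    by (intro continuous_intros continuous_on_stereo ballI ne)
  thus ?thesis
    by (subst continuous_on_cong[OF refl eq]) auto
qed

lemma open_range_Fin: "open (range Fin)"
  by (simp add: range_Fin open_Compl)

lemma open_Fin_image: assumes "open S" shows "open (Fin ` S)"
proof -
  have "Fin ` S = range Fin \<inter> fin_part -` S" by auto
  thus ?thesis
    using continuous_open_preimage[OF continuous_on_fin_part open_range_Fin assms] by simp
qed

lemma compact_Fin_image: "compact S \<Longrightarrow> compact (Fin ` S)"
  by (intro compact_continuous_image continuous_intros)

lemma compact_Fin_vimage:
  assumes "compact S" "S \<subseteq> range Fin" shows "compact (Fin -` S)"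
proof -
  have "Fin -` S = fin_part ` S" using assms(2) by force
  thus ?thesis
    using compact_continuous_image[OF continuous_on_subset[OF continuous_on_fin_part assms(2)] assms(1)]
    by simp
qed

lemma connected_Fin_image_iff: "connected (Fin ` S) \<longleftrightarrow> connected S"
proof
  assume "connected (Fin ` S)"
  hence "connected (fin_part ` Fin ` S)"
    by (rule connected_continuous_image[rotated])
       (auto intro: continuous_on_subset[OF continuous_on_fin_part])
  thus "connected S" by (simp add: image_image)
qed (intro connected_continuous_image continuous_intros)

lemma open_Infty_nbhd: "open (insert Infty (Fin ` {z. norm z > R}))"
proof -
  have "- insert Infty (Fin ` {z. norm z > R}) = Fin ` cball 0 R"
  proof (intro set_eqI)
    show "x \<in> - insert Infty (Fin ` {z. norm z > R}) \<longleftrightarrow> x \<in> Fin ` cball 0 R" for x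
      by (cases x) (auto simp: not_less image_iff)
  qed
  moreover have "closed (Fin ` cball 0 R)"
    by (intro compact_imp_closed compact_Fin_image compact_cball)
  ultimately show ?thesis
    by (simp add: open_closed)
qed

text \<open>The change of coordinates for the unbounded case of Montel's theorem: there the inverses
  of the normalised maps converge, and zeros of the limit must become the value
  \<open>Infty\<close>.\<close>

lemma continuous_on_moebius_sphere:
  assumes "c \<noteq> 0"
  shows "continuous_on UNIV (\<lambda>\<zeta>::complex. if \<zeta> = 0 then Infty else Fin (a + c / \<zeta>))"
    (is "continuous_on _ ?f")
proof -
  have "isCont ?f \<zeta>" for \<zeta>
  proof (cases "\<zeta> = 0")
    case True
    have "filterlim (\<lambda>\<zeta>. a + c / \<zeta>) at_infinity (at 0)"
      by (intro tendsto_add_filterlim_at_infinity[OF tendsto_const] filterlim_divide_at_infinity[OF tendsto_const])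
         (auto simp: assms filterlim_at eventually_at_filter)
    hence "((\<lambda>\<zeta>. Fin (a + c / \<zeta>)) \<longlongrightarrow> Infty) (at 0)"
      by (rule tendsto_Fin_Infty)
    hence "(?f \<longlongrightarrow> Infty) (at 0)"
      by (rule Lim_transform_eventually) (auto simp: eventually_at_filter)
    thus ?thesis by (simp add: True isCont_def)
  next
    case False
    have "((\<lambda>\<zeta>. Fin (a + c / \<zeta>)) \<longlongrightarrow> Fin (a + c / \<zeta>)) (at \<zeta>)"
      by (intro tendsto_Fin tendsto_intros False)
    moreover have "\<forall>\<^sub>F w in at \<zeta>. w \<noteq> 0"
      using False eventually_neq_at_within by blast
    hence "\<forall>\<^sub>F w in at \<zeta>. Fin (a + c / w) = ?f w"
      by eventually_elim auto
    ultimately have "(?f \<longlongrightarrow> Fin (a + c / \<zeta>)) (at \<zeta>)"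
      by (rule Lim_transform_eventually)
    thus ?thesis using False by (simp add: isCont_def)
  qed
  thus ?thesis by (simp add: continuous_at_imp_continuous_on)
qed

subsection \<open>Separation in the plane\<close>

lemma subset_outside:
  fixes S T :: "complex set"
  assumes "connected T" "\<not> bounded T" "T \<inter> S = {}"
  shows "T \<subseteq> outside S"
proof
  fix x assume "x \<in> T"
  hence "T \<subseteq> connected_component_set (- S) x"
    using assms by (intro connected_component_maximal) auto
  thus "x \<in> outside S"
    using assms(2) bounded_subset by (auto simp: outside)
qed

lemma connected_subset_inside_or_outside:
  assumes "connected T" "T \<inter> S = {}"
  shows "T \<subseteq> inside S \<or> T \<subseteq> outside S"
  using inside_outside_intersect_connected[of T S] inside_Un_outside[of S] assms by blast

text \<open>In the plane the exterior of the compact set \<open>B\<close> is connected and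
  unbounded, and it misses \<open>A\<close>.\<close>

lemma outside_antimono_inside:
  fixes A B :: "complex set"
  assumes "compact B" "A \<subseteq> inside B"
  shows "outside B \<subseteq> outside A"
proof (rule subset_outside)
  show "connected (outside B)" "\<not> bounded (outside B)"
    using assms(1) by (auto simp: connected_outside unbounded_outside compact_imp_bounded)
  show "outside B \<inter> A = {}"
    using assms(2) inside_Int_outside[of B] by blast
qed

text \<open>Mutual surrounding would give both sets the same exterior. Its closure can add only
  points lying in both sets, and these are disjoint; so the exterior would be clopen, yet it is
  neither empty nor the plane.\<close>

lemma inside_asym:
  fixes A B :: "complex set"
  assumes "compact A" "compact B" "A \<noteq> {}" "A \<subseteq> inside B" "B \<subseteq> inside A"
  shows False
proof -
  have eq: "outside A = outside B"
    using outside_antimono_inside assms by blast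
  have "closure (outside A) \<subseteq> (A \<union> outside A) \<inter> (B \<union> outside B)"
    using closure_outside_subset[of A] closure_outside_subset[of B] assms eq
    by (auto simp: compact_imp_closed)
  moreover have "A \<inter> B = {}"
    using assms inside_no_overlap[of B] by blast
  ultimately have "closure (outside A) \<subseteq> outside A"
    using eq by auto
  hence "closed (outside A)"
    by (simp add: closure_subset_eq)
  moreover have "open (outside A)"
    using assms(1) by (simp add: open_outside compact_imp_closed)
  ultimately have "outside A = {} \<or> outside A = UNIV"
    using clopen by blast
  moreover have "outside A \<noteq> {}"
    using unbounded_outside[of A] assms compact_imp_bounded by fastforce
  moreover have "outside A \<noteq> UNIV"
    using assms(3) outside_no_overlap[of A] by (metis Int_UNIV_left)
  ultimately show False by auto
qed

text \<open>If neither surrounds the other, each lies in the exterior of the other. Then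
  \<open>A\<close> with its holes filled is connected, misses \<open>B\<close> and so lies in the
  exterior of \<open>B\<close>; but it contains \<open>z\<close>.\<close>

lemma compact_connected_nested:
  fixes A B :: "complex set"
  assumes A: "compact A" "connected A" and B: "compact B" "connected B"
    and disj: "A \<inter> B = {}" and z: "z \<notin> outside A" "z \<notin> outside B"
  shows "A \<subseteq> inside B \<or> B \<subseteq> inside A"
proof (rule ccontr)
  assume contra: "\<not> ?thesis"
  hence AB: "A \<subseteq> outside B" "B \<subseteq> outside A"
    using connected_subset_inside_or_outside A B disj by (auto simp: inf_commute)
  have "connected (A \<union> inside A)"
    using A by (intro connected_with_inside compact_imp_closed)
  moreover have "(A \<union> inside A) \<inter> B = {}"
    using disj AB(2) inside_Int_outside[of A] by blast
  ultimately have "A \<union> inside A \<subseteq> inside B \<or> A \<union> inside A \<subseteq> outside B"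
    by (rule connected_subset_inside_or_outside)
  moreover have "A \<noteq> {}" using contra by auto
  hence "\<not> A \<union> inside A \<subseteq> inside B"
    using AB(1) inside_Int_outside[of B] by blast
  ultimately have "A \<union> inside A \<subseteq> outside B" by auto
  thus False using z by (auto simp: union_with_inside)
qed

lemma connected_subset_inside:
  assumes "connected T" "T \<inter> S = {}" "T \<inter> inside S \<noteq> {}"
  shows "T \<subseteq> inside S"
  using connected_subset_inside_or_outside[OF assms(1,2)] assms(3) inside_Int_outside[of S] by blast

lemma outside_frontier_full:
  fixes K :: "complex set"
  assumes "compact K" "connected (- K)"
  shows "outside (frontier K) = - K"
proof
  show "outside (frontier K) \<subseteq> - K"
    using outside_frontier_misses_closure[of K] assms closure_subset[of K] compact_imp_bounded by blast
  have "\<not> bounded (- K)"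
    using assms(1) compact_imp_bounded cobounded_imp_unbounded[of "- K"] by auto
  thus "- K \<subseteq> outside (frontier K)"
    using assms frontier_subset_closed[OF compact_imp_closed[OF assms(1)]]
    by (intro subset_outside) auto
qed

text \<open>The complement is a single complementary component of the connected set
  \<open>K\<close>, and such a component has connected frontier.\<close>

lemma connected_frontier_full:
  fixes K :: "complex set"
  assumes "connected K" "connected (- K)"
  shows "connected (frontier K)"
proof (cases "K = UNIV")
  case False
  hence "- K \<in> components (- K)"
    using assms(2) by (auto simp: in_components_self)
  from connected_frontier_component_complement[OF assms(1) this] show ?thesis
    by (simp add: frontier_complement)
qed auto

subsection \<open>Polynomials as maps of the plane\<close>

lemma open_poly_image:
  assumes "degree (p :: complex poly) \<ge> 1" "open U"
  shows "open (poly p ` U)"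
proof (rule open_mapping_thm[of "poly p" UNIV])
  show "\<not> poly p constant_on UNIV"
  proof
    assume "poly p constant_on UNIV"
    then obtain c where "\<And>z. poly p z = c" by (auto simp: constant_on_def)
    hence "p = [:c:]" by (intro poly_eqI_degree[of UNIV] poly_ext iffD1[OF poly_eq_poly_eq_iff]) auto
    thus False using assms(1) by auto
  qed
qed (use assms in \<open>auto simp: poly_holomorphic_on\<close>)

lemma poly_bounded_vimage:
  assumes "degree (p :: complex poly) \<ge> 1" "bounded A"
  shows "bounded (poly p -` A)"
proof -
  obtain B where B: "\<And>z. z \<in> A \<Longrightarrow> norm z \<le> B"
    using assms(2) by (auto simp: bounded_iff)
  have "filterlim (poly p) at_infinity at_infinity"
    using filterlim_poly_at_infinity[of p] assms(1) by simp
  hence "filterlim (\<lambda>z. norm (poly p z)) at_top at_infinity"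
    by (rule filterlim_at_infinity_imp_norm_at_top)
  hence "eventually (\<lambda>z. norm (poly p z) > B) at_infinity"
    by (simp add: filterlim_at_top_dense)
  then obtain R where "\<And>z. norm z \<ge> R \<Longrightarrow> norm (poly p z) > B"
    by (auto simp: eventually_at_infinity)
  hence "norm z \<le> R" if "poly p z \<in> A" for z
    using B[OF that] by (smt (verit))
  thus ?thesis by (auto simp: bounded_iff)
qed

lemma closed_poly_vimage: "closed A \<Longrightarrow> closed (poly (p :: complex poly) -` A)"
  by (intro continuous_closed_vimage) auto

lemma compact_poly_vimage:
  "degree (p :: complex poly) \<ge> 1 \<Longrightarrow> compact A \<Longrightarrow> compact (poly p -` A)"
  by (simp add: compact_eq_bounded_closed poly_bounded_vimage closed_poly_vimage)

lemma surj_poly: assumes "degree (p :: complex poly) \<ge> 1" shows "surj (poly p)"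
proof -
  have "\<exists>z. poly p z = w" for w
  proof -
    have "degree (p + [:- w:]) = degree p" using assms by (intro degree_add_eq_left) simp
    then obtain z where "poly (p + [:- w:]) z = 0"
      using fundamental_theorem_of_algebra[of "p + [:- w:]"] assms by (auto simp: constant_degree)
    thus ?thesis by auto
  qed
  thus ?thesis by (metis surj_def)
qed

text \<open>Polynomial maps are open and proper, hence confluent.\<close>

lemma poly_image_component:
  assumes p: "degree (p :: complex poly) \<ge> 1" and A: "compact A" "connected A"
    and C: "C \<in> components (poly p -` A)"
  shows "poly p ` C = A"
proof
  let ?S = "poly p -` A"
  show "poly p ` C \<subseteq> A" using in_components_subset[OF C] by auto
  show "A \<subseteq> poly p ` C"
  proof (rule ccontr)
    assume "\<not> A \<subseteq> poly p ` C"
    then obtain a where a: "a \<in> A" "a \<notin> poly p ` C" by auto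
    have S: "compact ?S" using compact_poly_vimage[OF p A(1)] .
    have "closedin (top_of_set ?S) C" using C closedin_component by blast
    hence "compact C" using S closedin_compact by blast
    moreover have "open (- (poly p -` {a}))" using closed_poly_vimage by auto
    moreover have "C \<subseteq> - (poly p -` {a})" using a by auto
    \<comment> \<open>By Sura-Bura the component is enlarged to a clopen piece of the preimage that
      still avoids the fibre over \<open>a\<close>. Unlike \<open>C\<close> itself, this piece has
      an image that is both open and closed in \<open>A\<close>.\<close>
    ultimately obtain M where M: "openin (top_of_set ?S) M" "compact M" "C \<subseteq> M" "M \<subseteq> - (poly p -` {a})"
      using Sura_Bura_clopen_subset[OF closed_imp_locally_compact[OF compact_imp_closed[OF S]] C] by metis
    obtain O' where O': "open O'" "M = ?S \<inter> O'" using M(1) unfolding openin_open by blast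
    have "poly p ` M = A \<inter> poly p ` O'" using O' by auto
    hence "openin (top_of_set A) (poly p ` M)"
      using open_poly_image[OF p O'(1)] by (auto simp: openin_open)
    moreover have "closedin (top_of_set A) (poly p ` M)"
      using M(2) \<open>poly p ` M = A \<inter> poly p ` O'\<close>
      by (intro closed_subset compact_imp_closed compact_continuous_image continuous_intros) auto
    ultimately have "poly p ` M = {} \<or> poly p ` M = A"
      using A(2) connected_clopen by blast
    moreover have "M \<noteq> {}" using M(3) in_components_nonempty[OF C] by auto
    ultimately show False using a M(4) by auto
  qed
qed

text \<open>The nontrivial inclusion is openness of the map: the image of a neighbourhood of
  \<open>z\<close> is a neighbourhood of \<open>poly p z\<close>.\<close>

lemma poly_vimage_closure:
  assumes "degree (p :: complex poly) \<ge> 1"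
  shows "closure (poly p -` A) = poly p -` closure A"
proof
  show "closure (poly p -` A) \<subseteq> poly p -` closure A"
    using closure_subset[of A] by (intro closure_minimal closed_poly_vimage) auto
  show "poly p -` closure A \<subseteq> closure (poly p -` A)"
  proof
    fix z assume z: "z \<in> poly p -` closure A"
    show "z \<in> closure (poly p -` A)"
      unfolding closure_iff_nhds_not_empty
    proof (intro allI impI)
      fix U V assume UV: "V \<subseteq> U" "open V" "z \<in> V"
      hence "open (poly p ` V)" "poly p z \<in> poly p ` V" using open_poly_image assms by auto
      hence "A \<inter> poly p ` V \<noteq> {}" using z closure_iff_nhds_not_empty[of "poly p z" A] by auto
      thus "poly p -` A \<inter> U \<noteq> {}" using UV by auto
    qed
  qed
qed

lemma poly_vimage_frontier:
  assumes "degree (p :: complex poly) \<ge> 1"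
  shows "frontier (poly p -` A) = poly p -` frontier A"
  using poly_vimage_closure[OF assms, of A] poly_vimage_closure[OF assms, of "- A"]
  by (simp add: frontier_closures vimage_Compl[symmetric] vimage_Int del: vimage_Compl)

text \<open>An unbounded complementary component has unbounded image because the map is proper.
  Conversely, let \<open>D\<close> be a bounded complementary component of the preimage. Its
  frontier maps into \<open>A\<close>, so if its image met the exterior of \<open>A\<close>,
  connectedness would force the compact image of \<open>closure D\<close> to cover that whole
  unbounded exterior.\<close>

lemma poly_vimage_outside:
  assumes p: "degree (p :: complex poly) \<ge> 1" and A: "compact A"
  shows "outside (poly p -` A) = poly p -` outside A"
proof
  show "outside (poly p -` A) \<subseteq> poly p -` outside A"
  proof
    fix x assume x: "x \<in> outside (poly p -` A)"
    define D where "D = connected_component_set (- (poly p -` A)) x"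
    have D: "\<not> bounded D" using x by (simp add: D_def outside)
    have "x \<notin> poly p -` A" using x outside_no_overlap by blast
    hence "x \<in> D" by (simp add: D_def)
    have "connected (poly p ` D)"
      unfolding D_def by (intro connected_continuous_image continuous_intros) auto
    moreover have "\<not> bounded (poly p ` D)"
    proof
      assume "bounded (poly p ` D)"
      from poly_bounded_vimage[OF p this] have "bounded D" by (rule bounded_subset) auto
      thus False using D by simp
    qed
    moreover have "poly p ` D \<inter> A = {}"
      using connected_component_subset[of "- (poly p -` A)" x] by (auto simp: D_def)
    ultimately have "poly p ` D \<subseteq> outside A" by (rule subset_outside)
    thus "x \<in> poly p -` outside A" using \<open>x \<in> D\<close> by auto
  qed
  show "poly p -` outside A \<subseteq> outside (poly p -` A)"
  proof (rule subsetI, rule ccontr)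
    fix x assume x: "x \<in> poly p -` outside A" "x \<notin> outside (poly p -` A)"
    define D where "D = connected_component_set (- (poly p -` A)) x"
    have D: "bounded D" using x by (simp add: D_def outside)
    have cl: "closed (poly p -` A)" using A by (intro closed_poly_vimage compact_imp_closed)
    hence oD: "open D" unfolding D_def by (intro open_connected_component) auto
    have "frontier D \<subseteq> frontier (- (poly p -` A))"
      unfolding D_def by (rule frontier_of_connected_component_subset)
    hence fD: "frontier D \<subseteq> poly p -` A"
      using frontier_subset_closed[OF cl] by (auto simp: frontier_complement)
    have "x \<notin> poly p -` A" using x(1) outside_no_overlap[of A] by blast
    hence xD: "x \<in> D" by (simp add: D_def)
    let ?W = "outside A"
    have conn: "connected ?W" using A by (simp add: connected_outside compact_imp_bounded)
    have o1: "open (poly p ` D)" by (rule open_poly_image[OF p oD])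
    have "compact (poly p ` closure D)"
      using D by (intro compact_continuous_image continuous_intros) auto
    hence o2: "open (- (poly p ` closure D))" by (simp add: compact_imp_closed open_Compl)
    have "closure D = D \<union> frontier D" using closure_Un_frontier by blast
    hence "?W \<subseteq> poly p ` D \<union> - (poly p ` closure D)"
      using fD outside_no_overlap[of A] by blast
    moreover have "poly p ` D \<inter> - (poly p ` closure D) \<inter> ?W = {}"
      using closure_subset[of D] by auto
    moreover have "poly p ` D \<inter> ?W \<noteq> {}" using xD x(1) by auto
    ultimately have "- (poly p ` closure D) \<inter> ?W = {}"
      using conn o1 o2 unfolding connected_def by (metis (no_types, lifting))
    hence "?W \<subseteq> poly p ` closure D" by auto
    hence "bounded ?W" using \<open>compact (poly p ` closure D)\<close> bounded_subset compact_imp_bounded by blast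
    thus False using unbounded_outside A compact_imp_bounded by blast
  qed
qed

lemma poly_vimage_inside:
  assumes "degree (p :: complex poly) \<ge> 1" "compact A"
  shows "inside (poly p -` A) = poly p -` inside A"
  by (simp add: inside_outside poly_vimage_outside[OF assms] vimage_Compl[symmetric] del: vimage_Compl)

text \<open>Meant for use with \<open>poly_image_component\<close>: components of a preimage map
  onto the given continuum, so each of them meets any \<open>T\<close> that contains a whole
  fibre.\<close>

lemma connected_if_components_meet:
  assumes T: "connected T" "T \<subseteq> S" and meet: "\<And>C. C \<in> components S \<Longrightarrow> C \<inter> T \<noteq> {}"
  shows "connected S"
proof -
  have "T \<subseteq> C" if "C \<in> components S" for C
    using components_maximal[OF that T] meet[OF that] by auto
  hence "C = C'" if "C \<in> components S" "C' \<in> components S" for C C'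
    using that meet[OF that(1)] components_eq[OF that] by blast
  hence "components S \<subseteq> {S}"
    using Union_components[of S] by blast
  hence "S = {} \<or> S \<in> components S"
    using components_eq_empty[of S] by blast
  thus ?thesis
    using in_components_connected[of S S] by auto
qed

text \<open>Lower the level \<open>c\<close> of the lemniscate \<open>\<bar>p\<bar> \<le> c\<close> as long as it stays connected; it can only
  stop at a critical level.\<close>

lemma connected_poly_vimage_cball:
  assumes p: "degree (p :: complex poly) \<ge> 1" and R: "R > 0"
    and crit: "\<And>z. poly (pderiv p) z = 0 \<Longrightarrow> norm (poly p z) \<le> R"
  shows "connected (poly p -` cball 0 R)"
proof -
  define L where "L c = poly p -` cball 0 c" for c
  define Z where "Z = {z. poly p z = 0}"
  have hol: "poly p holomorphic_on S" for S
    using poly_holomorphic_on[OF holomorphic_on_ident] by simp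
  have "p \<noteq> 0" using p by auto
  hence finZ: "finite Z" unfolding Z_def by (rule poly_roots_finite)
  have cL: "compact (L c)" for c
    unfolding L_def by (rule compact_poly_vimage[OF p compact_cball])
  \<comment> \<open>Every component of the lemniscate maps onto the disc and so contains a root; a
    connected set through all roots ties the components together.\<close>
  have conn: "connected (L c)" if T: "connected T" "Z \<subseteq> T" "T \<subseteq> L c" and c: "c \<ge> 0" for T c
  proof (rule connected_if_components_meet[OF T(1,3)])
    fix C assume "C \<in> components (L c)"
    hence "poly p ` C = cball 0 c"
      unfolding L_def by (intro poly_image_component[OF p]) auto
    hence "0 \<in> poly p ` C" using c by auto
    thus "C \<inter> T \<noteq> {}" using T(2) by (auto simp: Z_def)
  qed
  define S where "S = {c. R \<le> c \<and> connected (L c)}"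
  have "S \<noteq> {}"
  proof -
    obtain r where r: "Z \<subseteq> cball 0 r"
      using bounded_subset_ballD[OF finite_imp_bounded[OF finZ], of 0] ball_subset_cball subset_trans by meson
    have "compact (poly p ` cball 0 r)"
      by (intro compact_continuous_image continuous_intros) auto
    then obtain b where b: "poly p ` cball 0 r \<subseteq> cball 0 b"
      using bounded_subset_ballD[OF compact_imp_bounded, of _ 0] ball_subset_cball subset_trans by meson
    have "connected (L (max b R))"
    proof (rule conn[of "cball 0 r"])
      show "cball 0 r \<subseteq> L (max b R)"
        using b by (auto simp: L_def image_subset_iff le_max_iff_disj)
    qed (use r R in auto)
    hence "max b R \<in> S" by (simp add: S_def)
    thus ?thesis by blast
  qed
  \<comment> \<open>The infimum is attained, since \<open>L c\<close> is the intersection of a chain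
    of continua.\<close>
  define c where "c = Inf S"
  have bdd: "bdd_below S" unfolding S_def by (intro bdd_belowI[of _ R]) auto
  have "R \<le> c" unfolding c_def by (rule cInf_greatest[OF \<open>S \<noteq> {}\<close>]) (auto simp: S_def)
  have "L c = \<Inter> (L ` S)"
  proof
    show "L c \<subseteq> \<Inter> (L ` S)"
    proof
      fix z assume z: "z \<in> L c"
      have "c \<le> x" if "x \<in> S" for x
        unfolding c_def by (rule cInf_lower[OF that bdd])
      thus "z \<in> \<Inter> (L ` S)" using z by (auto simp: L_def intro: order_trans)
    qed
    show "\<Inter> (L ` S) \<subseteq> L c"
    proof
      fix z assume "z \<in> \<Inter> (L ` S)"
      hence "norm (poly p z) \<le> x" if "x \<in> S" for x using that by (auto simp: L_def)
      thus "z \<in> L c" using cInf_greatest[OF \<open>S \<noteq> {}\<close>, of "norm (poly p z)"] by (simp add: L_def c_def)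
    qed
  qed
  moreover have "connected (\<Inter> (L ` S))"
  proof (rule connected_chain)
    show "compact T \<and> connected T" if "T \<in> L ` S" for T
      using that cL by (auto simp: S_def)
    show "T \<subseteq> T' \<or> T' \<subseteq> T" if "T \<in> L ` S \<and> T' \<in> L ` S" for T T'
    proof -
      from that have "T \<in> L ` S" "T' \<in> L ` S" by simp_all
      then obtain x y where "T = L x" "T' = L y" by (elim imageE)
      thus ?thesis by (cases "x \<le> y") (auto simp: L_def)
    qed
  qed
  ultimately have conn_c: "connected (L c)" by simp
  have "\<not> R < c"
  proof
    assume Rc: "R < c"
    define U where "U = poly p -` ball 0 c"
    have oU: "open U" unfolding U_def by (intro open_vimage continuous_intros) auto
    have clU: "closure U = L c"
      unfolding U_def L_def poly_vimage_closure[OF p] using Rc R by simp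
    \<comment> \<open>Two pieces of the open lemniscate would have touching closures, because their
      union has the connected closure \<open>L c\<close>. The touching point lies on level
      \<open>c > R\<close>, hence is not critical, and \<open>p\<close> is injective near
      it.\<close>
    have "connected U"
    proof (rule ccontr)
      assume "\<not> connected U"
      then obtain A B where AB: "open A" "open B" "U \<subseteq> A \<union> B" "A \<inter> B \<inter> U = {}" "A \<inter> U \<noteq> {}" "B \<inter> U \<noteq> {}"
        unfolding connected_def by blast
      define B1 where "B1 = A \<inter> U"
      define B2 where "B2 = B \<inter> U"
      have B: "open B1" "open B2" "U = B1 \<union> B2" "B1 \<inter> B2 = {}" "B1 \<noteq> {}" "B2 \<noteq> {}"
        using AB oU by (auto simp: B1_def B2_def)
      have "closure B1 \<inter> closure B2 \<noteq> {}"
      proof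
        assume "closure B1 \<inter> closure B2 = {}"
        moreover have "L c = closure B1 \<union> closure B2" using clU B(3) by simp
        moreover have "closure B1 \<noteq> {}" "closure B2 \<noteq> {}" using B by auto
        ultimately have "\<exists>A B. closed A \<and> closed B \<and> L c \<subseteq> A \<union> B \<and> A \<inter> B \<inter> L c = {} \<and>
            A \<inter> L c \<noteq> {} \<and> B \<inter> L c \<noteq> {}"
          by (intro exI[of _ "closure B1"] exI[of _ "closure B2"]) auto
        thus False using conn_c unfolding connected_closed by simp
      qed
      then obtain z where z: "z \<in> closure B1" "z \<in> closure B2" by auto
      have "z \<notin> B1" using z(2) B(1,4) open_Int_closure_eq_empty by blast
      moreover have "z \<notin> B2" using z(1) B(2,4) open_Int_closure_eq_empty[of B2 B1] by blast
      moreover have "z \<in> L c" using z(1) clU B(3) by auto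
      ultimately have "norm (poly p z) = c" using B(3) by (auto simp: L_def U_def)
      hence "poly (pderiv p) z \<noteq> 0" using crit[of z] Rc by auto
      hence "deriv (poly p) z \<noteq> 0" using DERIV_imp_deriv[OF poly_DERIV] by metis
      then obtain r where r: "r > 0" "inj_on (poly p) (ball z r)"
        using has_complex_derivative_locally_injective[OF hol, of z UNIV] by auto
      obtain g where g: "g holomorphic_on (poly p ` ball z r)" "\<And>w. w \<in> ball z r \<Longrightarrow> g (poly p w) = w"
        by (rule holomorphic_has_inverse[OF hol open_ball r(2)]) blast
      have "open (poly p ` ball z r)" by (rule open_poly_image[OF p open_ball])
      then obtain e where e: "e > 0" "ball (poly p z) e \<subseteq> poly p ` ball z r"
        using r(1) unfolding open_contains_ball by (meson centre_in_ball imageI)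
      \<comment> \<open>The intersection of the two discs is convex, so its image under the local
        inverse is connected. Near \<open>z\<close> it contains all of \<open>U\<close>, so it meets
        both pieces.\<close>
      define N where "N = g ` (ball (poly p z) e \<inter> ball 0 c)"
      have "connected N" unfolding N_def
        using e(2) holomorphic_on_imp_continuous_on[OF g(1)]
        by (intro connected_continuous_image convex_connected convex_Int convex_ball)
           (auto intro: continuous_on_subset)
      have gN: "x \<in> N" if "x \<in> ball z r" "poly p x \<in> ball (poly p z) e" "x \<in> U" for x
        using that g(2)[OF that(1)] by (auto simp: N_def U_def intro!: image_eqI[of _ _ "poly p x"])
      have NU: "N \<subseteq> U"
        using e(2) g(2) by (force simp: N_def U_def)
      let ?V = "ball z r \<inter> poly p -` ball (poly p z) e"
      have V: "open ?V" "z \<in> ?V"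
        using r(1) e(1) by (auto intro!: open_Int open_vimage continuous_intros)
      have meet: "B \<inter> N \<noteq> {}" if zB: "z \<in> closure B" and BU: "B \<subseteq> U" for B
      proof -
        have "?V \<inter> B \<noteq> {}"
          using open_Int_closure_eq_empty[OF V(1), of B] zB V(2) by blast
        then obtain x where x: "x \<in> ?V" "x \<in> B" by blast
        hence "x \<in> N" using BU by (intro gN) auto
        thus ?thesis using x(2) by auto
      qed
      have "B1 \<inter> N \<noteq> {}" "B2 \<inter> N \<noteq> {}"
        using meet[OF z(1)] meet[OF z(2)] B(3) by auto
      moreover have "N \<subseteq> B1 \<union> B2" "B1 \<inter> B2 \<inter> N = {}" using NU B by auto
      ultimately show False
        using \<open>connected N\<close> B(1,2) unfolding connected_def by blast
    qed
    hence "path_connected U" using oU by (intro connected_open_path_connected)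
    have ZU: "Z \<subseteq> U" using Rc R by (auto simp: Z_def U_def)
    obtain z1 where z1: "z1 \<in> Z" using surjD[OF surj_poly[OF p], of 0] by (auto simp: Z_def)
    have "\<forall>z\<in>Z. \<exists>g. path g \<and> path_image g \<subseteq> U \<and> pathstart g = z1 \<and> pathfinish g = z"
      using \<open>path_connected U\<close> ZU z1 unfolding path_connected_def by blast
    then obtain g where g: "\<And>z. z \<in> Z \<Longrightarrow> path (g z) \<and> path_image (g z) \<subseteq> U \<and> pathstart (g z) = z1 \<and> pathfinish (g z) = z"
      by metis
    \<comment> \<open>A compact connected set in \<open>U\<close> through all roots. On it the
      maximum of \<open>|p|\<close> is below \<open>c\<close>, which produces a connected lemniscate
      at a level smaller than the infimum.\<close>
    define T where "T = (\<Union>z\<in>Z. path_image (g z))"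
    have "z1 \<in> path_image (g z)" "z \<in> path_image (g z)" if "z \<in> Z" for z
      using g[OF that] pathstart_in_path_image[of "g z"] pathfinish_in_path_image[of "g z"] by simp_all
    hence ZT: "Z \<subseteq> T" and z1T: "z1 \<in> (\<Inter>z\<in>Z. path_image (g z))" by (auto simp: T_def)
    have "connected T" unfolding T_def
    proof (rule connected_Union)
      show "connected s" if "s \<in> (\<lambda>z. path_image (g z)) ` Z" for s
        using that g by (auto intro: connected_path_image)
    qed (use z1T in auto)
    have "compact T" unfolding T_def
      using finZ g by (intro compact_UN) (auto intro: compact_path_image)
    have "T \<noteq> {}" using ZT z1 by auto
    obtain x where x: "x \<in> T" "\<And>y. y \<in> T \<Longrightarrow> norm (poly p y) \<le> norm (poly p x)"
      using continuous_attains_sup[OF \<open>compact T\<close> \<open>T \<noteq> {}\<close>, of "\<lambda>x. norm (poly p x)"]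
        continuous_on_norm[OF continuous_on_poly[OF continuous_on_id]] by blast
    have "x \<in> U" using x(1) g by (auto simp: T_def)
    hence lt: "max R (norm (poly p x)) < c" using Rc by (simp add: U_def)
    have "connected (L (max R (norm (poly p x))))"
    proof (rule conn[OF \<open>connected T\<close> ZT])
      show "T \<subseteq> L (max R (norm (poly p x)))"
        using x(2) by (auto simp: L_def le_max_iff_disj)
    qed (use R in auto)
    hence "max R (norm (poly p x)) \<in> S" by (simp add: S_def)
    hence "c \<le> max R (norm (poly p x))" unfolding c_def by (rule cInf_lower[OF _ bdd])
    thus False using lt by simp
  qed
  hence "c = R" using \<open>R \<le> c\<close> by simp
  thus ?thesis using conn_c by (simp add: L_def)
qed

subsection \<open>Filled Julia sets\<close>

definition filled_julia :: "complex poly \<Rightarrow> complex set" where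
  "filled_julia p = {z. bounded (range (\<lambda>n. (poly p ^^ n) z))}"

text \<open>Iterates as polynomials, so that degrees, derivatives and the preimage lemmas apply to
  them.\<close>

definition poly_iterate :: "complex poly \<Rightarrow> nat \<Rightarrow> complex poly" where
  "poly_iterate p n = (pcompose p ^^ n) [:0, 1:]"

lemma poly_poly_iterate: "poly (poly_iterate p n) = poly p ^^ n"
  by (induction n) (auto simp: poly_iterate_def poly_pcompose fun_eq_iff)

lemma degree_poly_iterate: "degree (poly_iterate p n) = degree p ^ n"
  by (induction n) (auto simp: poly_iterate_def degree_pcompose)

lemma degree_poly_iterate_ge: "degree p \<ge> 1 \<Longrightarrow> degree (poly_iterate p n) \<ge> 1"
  by (simp add: degree_poly_iterate)

text \<open>The factor two gives geometric growth of escaping orbits, and a radius common to two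
  polynomials also serves their composition.\<close>

definition escape_radius :: "complex poly \<Rightarrow> real \<Rightarrow> bool" where
  "escape_radius p R \<longleftrightarrow> R > 0 \<and> (\<forall>z. norm z > R \<longrightarrow> norm (poly p z) \<ge> 2 * norm z)"

lemma escape_radius_mono: "escape_radius p R \<Longrightarrow> R \<le> R' \<Longrightarrow> escape_radius p R'"
  by (auto simp: escape_radius_def)

text \<open>Write \<open>p\<close> as \<open>a + z * q(z)\<close> with \<open>q\<close> nonconstant.
  Far out \<open>|q|\<close> exceeds \<open>2 + |a|\<close>, and for \<open>|z| \<ge> 1\<close> the
  surplus \<open>|a| * |z|\<close> pays for the constant term.\<close>

lemma escape_radius_exists:
  assumes "degree p \<ge> 2"
  obtains R where "R \<ge> R0" "escape_radius p R"
proof -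
  obtain a q where p: "p = pCons a q" by (cases p)
  have "filterlim (poly q) at_infinity at_infinity"
    using filterlim_poly_at_infinity[of q] assms p by (simp split: if_splits)
  hence "filterlim (\<lambda>z. norm (poly q z)) at_top at_infinity"
    by (rule filterlim_at_infinity_imp_norm_at_top)
  hence "eventually (\<lambda>z. norm (poly q z) > 2 + norm a) at_infinity"
    by (simp add: filterlim_at_top_dense)
  then obtain b where b: "\<And>z. norm z \<ge> b \<Longrightarrow> norm (poly q z) > 2 + norm a"
    by (auto simp: eventually_at_infinity)
  define R where "R = Max {1, R0, b}"
  have R: "R \<ge> 1" "R \<ge> R0" "R \<ge> b" by (auto simp: R_def)
  have "norm (poly p z) \<ge> 2 * norm z" if z: "norm z > R" for z
  proof -
    have "norm z * (2 + norm a) \<le> norm z * norm (poly q z)"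
      using b[of z] z R by (intro mult_left_mono) auto
    also have "\<dots> = norm (poly p z - a)" by (simp add: p norm_mult)
    also have "\<dots> \<le> norm (poly p z) + norm a" by (rule norm_triangle_ineq4)
    finally have "norm z * 2 + norm z * norm a \<le> norm (poly p z) + norm a"
      by (simp add: algebra_simps)
    moreover have "1 * norm a \<le> norm z * norm a" using z R by (intro mult_right_mono) auto
    ultimately show ?thesis by simp
  qed
  thus ?thesis using R by (intro that[of R]) (auto simp: escape_radius_def)
qed

lemma escape_funpow:
  assumes esc: "escape_radius p R" and z: "norm z > R"
  shows "norm ((poly p ^^ n) z) \<ge> 2 ^ n * norm z"
proof (induction n)
  case (Suc n)
  have "1 * norm z \<le> 2 ^ n * norm z" by (rule mult_right_mono) auto
  hence "norm ((poly p ^^ n) z) > R" using Suc z by linarith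
  hence "norm (poly p ((poly p ^^ n) z)) \<ge> 2 * norm ((poly p ^^ n) z)"
    using esc by (simp add: escape_radius_def)
  thus ?case using Suc by simp
qed simp

text \<open>An orbit that leaves the disc once at least doubles in norm from then on and so is
  unbounded.\<close>

lemma filled_julia_eq:
  assumes esc: "escape_radius p R"
  shows "filled_julia p = {z. \<forall>n. norm ((poly p ^^ n) z) \<le> R}"
proof (rule antisym)
  show "{z. \<forall>n. norm ((poly p ^^ n) z) \<le> R} \<subseteq> filled_julia p"
    by (auto simp: filled_julia_def bounded_iff)
  show "filled_julia p \<subseteq> {z. \<forall>n. norm ((poly p ^^ n) z) \<le> R}"
  proof (intro subsetI CollectI allI, rule ccontr)
    fix z n assume "z \<in> filled_julia p" and n: "\<not> norm ((poly p ^^ n) z) \<le> R"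
    then obtain B where B: "\<And>n. norm ((poly p ^^ n) z) \<le> B"
      by (auto simp: filled_julia_def bounded_iff)
    have R: "R > 0" using esc by (simp add: escape_radius_def)
    obtain k where k: "B / R < 2 ^ k" using real_arch_pow[of 2 "B / R"] by auto
    have "B < 2 ^ k * R" using k R by (simp add: field_simps)
    also have "\<dots> \<le> 2 ^ k * norm ((poly p ^^ n) z)" using n by (intro mult_left_mono) auto
    also have "\<dots> \<le> norm ((poly p ^^ k) ((poly p ^^ n) z))"
      using n by (intro escape_funpow[OF esc]) simp
    also have "\<dots> = norm ((poly p ^^ (k + n)) z)" by (simp add: funpow_add)
    finally show False using B[of "k + n"] by simp
  qed
qed

lemma vimage_filled_julia: "poly p -` filled_julia p = filled_julia p"
proof -
  have "range (\<lambda>n. (poly p ^^ n) z) = insert z (range (\<lambda>n. (poly p ^^ n) (poly p z)))" for z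
  proof -
    have "range (\<lambda>n. (poly p ^^ n) z) = insert ((poly p ^^ 0) z) (range (\<lambda>n. (poly p ^^ Suc n) z))"
    proof (intro set_eqI iffI)
      fix w assume "w \<in> range (\<lambda>n. (poly p ^^ n) z)"
      then obtain n where "w = (poly p ^^ n) z" by blast
      thus "w \<in> insert ((poly p ^^ 0) z) (range (\<lambda>n. (poly p ^^ Suc n) z))"
        by (cases n) auto
    qed blast
    thus ?thesis by (simp add: funpow_swap1)
  qed
  hence "bounded (range (\<lambda>n. (poly p ^^ n) z)) \<longleftrightarrow> bounded (range (\<lambda>n. (poly p ^^ n) (poly p z)))" for z
    by (metis bounded_insert)
  thus ?thesis by (simp add: filled_julia_def vimage_def)
qed

lemma funpow_vimage_filled_julia: "(poly p ^^ n) -` filled_julia p = filled_julia p"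
proof (induction n)
  case (Suc n)
  have "(poly p ^^ Suc n) -` filled_julia p = poly p -` ((poly p ^^ n) -` filled_julia p)"
    by (simp only: funpow_Suc_right vimage_comp)
  also have "\<dots> = filled_julia p" using Suc by (simp add: vimage_filled_julia)
  finally show ?case .
qed simp

lemma filled_julia_Inter:
  assumes "escape_radius p R"
  shows "filled_julia p = (\<Inter>n. poly (poly_iterate p n) -` cball 0 R)"
  unfolding filled_julia_eq[OF assms] by (auto simp: poly_poly_iterate)

lemma compact_filled_julia:
  assumes "degree p \<ge> 2" shows "compact (filled_julia p)"
proof -
  obtain R where R: "escape_radius p R"
    using escape_radius_exists[OF assms] by metis
  have "compact (poly (poly_iterate p n) -` cball 0 R)" for n
    using degree_poly_iterate_ge[of p n] assms by (intro compact_poly_vimage) auto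
  thus ?thesis
    unfolding filled_julia_Inter[OF R] by (intro compact_Inter) auto
qed

text \<open>The filled Julia set is an intersection of polynomial preimages of a disc. None of these
  has holes, because exteriors commute with polynomial preimages.\<close>

lemma outside_filled_julia:
  assumes "degree p \<ge> 2" shows "outside (filled_julia p) = - filled_julia p"
proof
  obtain R where R: "escape_radius p R"
    using escape_radius_exists[OF assms] by metis
  have "- (poly (poly_iterate p n) -` cball 0 R) \<subseteq> outside (filled_julia p)" for n
  proof -
    have "- (poly (poly_iterate p n) -` cball 0 R) = poly (poly_iterate p n) -` outside (cball 0 R)"
      by (simp add: outside_convex vimage_Compl)
    also have "\<dots> = outside (poly (poly_iterate p n) -` cball 0 R)"
      using degree_poly_iterate_ge[of p n] assms by (subst poly_vimage_outside) auto
    also have "\<dots> \<subseteq> outside (filled_julia p)"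
      unfolding filled_julia_Inter[OF R] by (intro outside_mono) auto
    finally show ?thesis .
  qed
  thus "- filled_julia p \<subseteq> outside (filled_julia p)"
    by (subst (1) filled_julia_Inter[OF R]) auto
qed (use outside_no_overlap[of "filled_julia p"] in blast)

lemma filled_julia_nonempty:
  assumes "degree p \<ge> 2" shows "filled_julia p \<noteq> {}"
proof -
  have "degree (p + [:0, - 1:]) = degree p" using assms by (intro degree_add_eq_left) simp
  then obtain z where "poly (p + [:0, - 1:]) z = 0"
    using fundamental_theorem_of_algebra[of "p + [:0, - 1:]"] assms by (auto simp: constant_degree)
  hence "poly p z = z" by simp
  hence "(poly p ^^ n) z = z" for n by (induction n) auto
  hence "z \<in> filled_julia p" by (simp add: filled_julia_def)
  thus ?thesis by auto
qed

lemma connected_Compl_vimage_filled_julia: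
  assumes p: "degree p \<ge> 2" and g: "degree g \<ge> 1"
  shows "connected (- (poly g -` filled_julia p))"
proof -
  have "- (poly g -` filled_julia p) = poly g -` outside (filled_julia p)"
    by (simp add: outside_filled_julia[OF p] vimage_Compl)
  also have "\<dots> = outside (poly g -` filled_julia p)"
    by (rule poly_vimage_outside[OF g compact_filled_julia[OF p], symmetric])
  finally show ?thesis
    using compact_poly_vimage[OF g compact_filled_julia[OF p]]
    by (simp add: connected_outside compact_imp_bounded)
qed

text \<open>The preimage is a decreasing intersection of lemniscates of the polynomials "iterate of
  \<open>p\<close> after \<open>g\<close>". The level \<open>R\<close> is taken beyond both the
  escape radius and the critical bound \<open>R0\<close>, so the lemniscates are nested and
  connected.\<close>

lemma connected_vimage_filled_julia:
  assumes p: "degree p \<ge> 2" and g: "degree g \<ge> 1"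
    and crit: "\<And>n z. poly (pderiv (pcompose (poly_iterate p n) g)) z = 0 \<Longrightarrow>
      norm (poly (pcompose (poly_iterate p n) g) z) \<le> R0"
  shows "connected (poly g -` filled_julia p)"
proof -
  obtain R where R: "R \<ge> R0" "escape_radius p R"
    using escape_radius_exists[OF p, of R0] by metis
  hence "R > 0" by (simp add: escape_radius_def)
  define S where "S n = poly (pcompose (poly_iterate p n) g) -` cball 0 R" for n
  have deg: "degree (pcompose (poly_iterate p n) g) \<ge> 1" for n
    using degree_poly_iterate_ge[of p n] p g by (simp add: degree_pcompose)
  have "poly g -` filled_julia p = \<Inter> (range S)"
    unfolding filled_julia_Inter[OF R(2)] by (auto simp: S_def poly_pcompose)
  moreover have "connected (\<Inter> (range S))"
  proof (rule connected_nest)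
    show "compact (S n)" for n
      unfolding S_def by (rule compact_poly_vimage[OF deg compact_cball])
    show "connected (S n)" for n
      unfolding S_def by (rule connected_poly_vimage_cball[OF deg \<open>R > 0\<close> order_trans[OF crit R(1)]])
    have "S (Suc n) \<subseteq> S n" for n
    proof (rule subsetI, rule ccontr)
      fix z assume z: "z \<in> S (Suc n)" "z \<notin> S n"
      define w where "w = (poly p ^^ n) (poly g z)"
      have "norm w > R" using z(2) by (simp add: S_def w_def poly_pcompose poly_poly_iterate)
      moreover have "norm (poly p w) \<le> R"
        using z(1) by (simp add: S_def w_def poly_pcompose poly_poly_iterate)
      ultimately show False using R(2) \<open>R > 0\<close> unfolding escape_radius_def by (smt (verit))
    qed
    thus "S n \<subseteq> S m" if "m \<le> n" for m n
      using that lift_Suc_antimono_le[of S] by blast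
  qed
  ultimately show ?thesis by simp
qed

text \<open>Suppose the frontier is one point \<open>c\<close>. As the punctured plane is connected,
  the filled Julia set is \<open>{c}\<close>, so \<open>c\<close> is its own only preimage. Degree
  at least two then makes \<open>c\<close> a double root of \<open>p - c\<close>, that is, a
  superattracting fixed point, and nearby orbits are bounded as well.\<close>

lemma frontier_filled_julia_two_points:
  assumes p: "degree p \<ge> 2"
  shows "\<exists>a \<in> frontier (filled_julia p). \<exists>b \<in> frontier (filled_julia p). a \<noteq> b"
proof (rule ccontr)
  let ?K = "filled_julia p"
  note K = compact_filled_julia[OF p]
  assume no: "\<not> ?thesis"
  have neU: "?K \<noteq> UNIV" using compact_imp_bounded[OF K] not_bounded_UNIV by force
  then obtain c where c: "c \<in> frontier ?K"
    using frontier_not_empty[OF filled_julia_nonempty[OF p]] by auto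
  hence fr: "frontier ?K = {c}" using no by blast
  have "?K = {c}"
  proof (rule ccontr)
    assume "?K \<noteq> {c}"
    moreover have "c \<in> ?K" using c frontier_subset_closed compact_imp_closed[OF K] by blast
    ultimately have 1: "(- {c}) \<inter> ?K \<noteq> {}" by auto
    have "\<not> bounded (UNIV :: complex set)" by (rule not_bounded_UNIV)
    hence "- {c} - ?K \<noteq> {}"
      using K \<open>c \<in> ?K\<close> neU by auto
    moreover have "connected (- {c})" by (rule connected_punctured_universe) auto
    ultimately have "(- {c}) \<inter> frontier ?K \<noteq> {}" using 1 by (intro connected_Int_frontier)
    thus False using fr by auto
  qed
  hence root: "poly p z = c \<longleftrightarrow> z = c" for z
    using vimage_filled_julia[of p] unfolding \<open>?K = {c}\<close> by blast
  have "poly (p - [:c:]) c = 0" using root by simp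
  then obtain q where q: "p - [:c:] = [:- c, 1:] * q"
    unfolding poly_eq_0_iff_dvd dvd_def by blast
  have "p - [:c:] = p + [:- c:]" by simp
  hence "degree p = degree (p - [:c:])"
    using degree_add_eq_left[of "[:- c:]" p] p by (simp only:) simp
  also have "\<dots> = Suc (degree q)"
  proof (cases "q = 0")
    case True
    hence "p = [:c:]" using q by simp
    thus ?thesis using p by simp
  next
    case False
    have "degree ([:- c, 1:] * q) = degree [:- c, 1:] + degree q"
      using False by (intro degree_mult_eq) auto
    thus ?thesis unfolding q by simp
  qed
  finally have "\<not> constant (poly q)" using p by (simp add: constant_degree)
  then obtain w where w: "poly q w = 0" using fundamental_theorem_of_algebra by blast
  have "poly (p - [:c:]) w = 0" unfolding q using w by simp
  hence "w = c" using root[of w] by simp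
  hence "poly q c = 0" using w by simp
  then obtain s where s: "q = [:- c, 1:] * s"
    unfolding poly_eq_0_iff_dvd dvd_def by blast
  have pz: "poly p z - c = (z - c)\<^sup>2 * poly s z" for z
  proof -
    have "poly p z - c = poly (p - [:c:]) z" by simp
    thus ?thesis unfolding q s by (simp add: power2_eq_square algebra_simps)
  qed
  have "compact (poly s ` cball c 1)" by (intro compact_continuous_image continuous_intros) auto
  hence "bounded (poly s ` cball c 1)" by (rule compact_imp_bounded)
  then obtain M where M: "M > 0" "\<And>z. z \<in> cball c 1 \<Longrightarrow> norm (poly s z) \<le> M"
    unfolding bounded_pos by (auto simp del: mem_cball)
  \<comment> \<open>With \<open>d * M \<le> 1\<close> the estimate
    \<open>|p(z) - c| = |z - c|^2 * |s(z)|\<close> makes the disc of radius \<open>d\<close> forward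
    invariant.\<close>
  define d where "d = min 1 (1 / M)"
  have d: "d > 0" "d \<le> 1" "d * M \<le> 1" using M(1) by (auto simp: d_def min_def field_simps)
  have inv: "poly p z \<in> cball c d" if "z \<in> cball c d" for z
  proof -
    have zd: "norm (z - c) \<le> d" using that by (simp add: dist_norm norm_minus_commute)
    have "norm (poly p z - c) = norm (z - c) * (norm (z - c) * norm (poly s z))"
      unfolding pz by (simp add: norm_mult norm_power power2_eq_square)
    also have "norm (z - c) * norm (poly s z) \<le> d * M"
      using zd M(2)[of z] d by (intro mult_mono) (auto simp: dist_norm norm_minus_commute)
    hence "norm (z - c) * (norm (z - c) * norm (poly s z)) \<le> d * 1"
      using zd d by (intro mult_mono) auto
    finally show ?thesis by (simp add: dist_norm norm_minus_commute)
  qed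
  have "(poly p ^^ n) (c + of_real d) \<in> cball c d" for n
  proof (induction n)
    case 0
    show ?case using d(1) by (simp add: dist_norm)
  qed (use inv in simp)
  hence "bounded (range (\<lambda>n. (poly p ^^ n) (c + of_real d)))"
    by (intro bounded_subset[OF bounded_cball[of c d]] image_subsetI)
  hence "c + of_real d \<in> ?K" by (simp add: filled_julia_def)
  thus False using \<open>?K = {c}\<close> d(1) by simp
qed

subsection \<open>Normal families of polynomials\<close>

lemma normal_on_subset:
  assumes "normal_on F U" "F' \<subseteq> F" shows "normal_on F' U"
  using assms unfolding normal_on_def by (meson subset_trans)

text \<open>Montel's theorem for uniformly bounded families, followed by a coordinate change
  \<open>M\<close> into the sphere. Uniform limits survive \<open>M\<close> because it is uniformly
  continuous on the disc of radius \<open>B\<close>.\<close>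

lemma bounded_sphere_subsequence:
  assumes "open S" and hol: "\<And>n. h n holomorphic_on S"
    and bd: "\<And>n z. z \<in> S \<Longrightarrow> norm (h n z) \<le> B" and M: "continuous_on UNIV M"
  shows "\<exists>r l. strict_mono (r :: nat \<Rightarrow> nat) \<and> (\<forall>K. compact K \<and> K \<subseteq> Fin ` S \<longrightarrow>
    uniform_limit K (\<lambda>n x. M (h (r n) (fin_part x)) :: riemann_sphere) l sequentially)"
proof -
  obtain g r where g: "strict_mono (r :: nat \<Rightarrow> nat)"
      "\<And>x. x \<in> S \<Longrightarrow> ((\<lambda>n. h (r n) x) \<longlongrightarrow> g x) sequentially"
      "\<And>K. compact K \<Longrightarrow> K \<subseteq> S \<Longrightarrow> uniform_limit K (h \<circ> r) g sequentially"
  proof (rule Montel[of S "range h" h])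
    show "\<exists>B. \<forall>h\<in>range h. \<forall>z\<in>K. norm (h z) \<le> B" if "compact K" "K \<subseteq> S" for K
      using bd that(2) by (intro exI[of _ B]) auto
  qed (use assms hol in auto)
  have gB: "norm (g x) \<le> B" if "x \<in> S" for x
    by (rule tendsto_upperbound[OF tendsto_norm[OF g(2)[OF that]]]) (use bd that in auto)
  have "uniform_limit K (\<lambda>n x. M (h (r n) (fin_part x))) (\<lambda>x. (M \<circ> g) (fin_part x)) sequentially"
    if K: "compact K" "K \<subseteq> Fin ` S" for K
  proof (rule uniform_limit_compose')
    have KS: "Fin -` K \<subseteq> S" using K(2) by auto
    have "compact (Fin -` K)" using K by (intro compact_Fin_vimage) auto
    hence lim: "uniform_limit (Fin -` K) (\<lambda>n. h (r n)) g sequentially"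
      using g(3)[OF _ KS] by (simp add: o_def)
    show "uniform_limit (Fin -` K) (\<lambda>n x. M (h (r n) x)) (M \<circ> g) sequentially"
    proof (rule uniform_limit_compose[OF lim])
      show "uniformly_continuous_on (cball 0 B) M"
        by (intro compact_uniformly_continuous continuous_on_subset[OF M]) auto
    qed (use bd gB KS in \<open>auto intro!: always_eventually\<close>)
    show "fin_part \<in> K \<rightarrow> Fin -` K" using K(2) by auto
  qed
  thus ?thesis using g(1) by blast
qed

text \<open>Normalised to omit \<open>0\<close> and \<open>1\<close>, either infinitely many of the maps are small at \<open>w\<close> or
  infinitely many of their inverses are; Schottky's theorem bounds these near \<open>w\<close>.\<close>

lemma normal_omitting_two_values:
  assumes ab: "a \<noteq> b" and e: "e > 0"
    and omit: "\<And>q z. q \<in> Q \<Longrightarrow> z \<in> ball w e \<Longrightarrow> poly q z \<noteq> a \<and> poly q z \<noteq> b"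
  shows "\<exists>U. open U \<and> Fin w \<in> U \<and> normal_on (sphere_poly ` Q) U"
proof -
  define nf where "nf q z = (poly q z - a) / (b - a)" for q z
  have nf: "nf q z \<noteq> 0" "nf q z \<noteq> 1" if "q \<in> Q" "z \<in> ball w e" for q z
    using omit[OF that] ab by (auto simp: nf_def)
  have hnf: "nf q holomorphic_on S" for q S
    unfolding nf_def by (intro holomorphic_intros) (use ab in auto)
  \<comment> \<open>Inversion preserves the omission of \<open>0\<close> and \<open>1\<close>, and
    for each \<open>q\<close> one of the two maps has norm at most \<open>1\<close> at
    \<open>w\<close>, hence belongs to \<open>Y\<close>.\<close>
  define X where "X = nf ` Q \<union> (\<lambda>q z. inverse (nf q z)) ` Q"
  define Y where "Y = {h \<in> X. norm (h w) \<le> 1}"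
  obtain B Z where BZ: "0 < B" "open Z" "w \<in> Z" "Z \<subseteq> ball w e"
    "\<And>h z. h \<in> Y \<Longrightarrow> z \<in> Z \<Longrightarrow> norm (h z) \<le> B"
  proof (rule GPicard1[of "ball w e" w 1 Y X])
    show "h holomorphic_on ball w e" if "h \<in> X" for h
      using that hnf nf(1) by (auto simp: X_def intro!: holomorphic_on_inverse)
    show "h z \<noteq> 0 \<and> h z \<noteq> 1" if "h \<in> X" "z \<in> ball w e" for h z
      using that(1) nf[OF _ that(2)] by (auto simp: X_def)
  qed (use e in \<open>auto simp: Y_def\<close>)
  have hY: "h holomorphic_on Z" if "h \<in> Y" for h
    using that hnf nf(1) BZ(4) by (force simp: X_def Y_def intro!: holomorphic_on_inverse)
  have "normal_on (sphere_poly ` Q) (Fin ` Z)"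
    unfolding normal_on_def
  proof (intro allI impI)
    fix f :: "nat \<Rightarrow> riemann_sphere \<Rightarrow> riemann_sphere"
    assume "range f \<subseteq> sphere_poly ` Q"
    hence "\<exists>q. \<forall>n. q n \<in> Q \<and> f n = sphere_poly (q n)" by (intro choice) auto
    then obtain q where q: "\<And>n. q n \<in> Q" "\<And>n. f n = sphere_poly (q n)" by blast
    define I where "I = {n. norm (nf (q n) w) \<le> 1}"
    have key: "\<exists>r l. strict_mono (r :: nat \<Rightarrow> nat) \<and>
        (\<forall>K. compact K \<and> K \<subseteq> Fin ` Z \<longrightarrow> uniform_limit K (\<lambda>n. f (r n)) l sequentially)"
      \<comment> \<open>One argument for both cases: \<open>s\<close> picks the subsequence,
        \<open>h\<close> is its bounded normalised form, and \<open>M\<close> undoes the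
        normalisation.\<close>
      if s: "strict_mono (s :: nat \<Rightarrow> nat)" and hYn: "\<And>n. h n \<in> Y" and M: "continuous_on UNIV M"
        and eq: "\<And>n z. z \<in> Z \<Longrightarrow> Fin (poly (q (s n)) z) = M (h n z)" for s h M
    proof -
      obtain r l where rl: "strict_mono (r :: nat \<Rightarrow> nat)"
        "\<And>K. compact K \<and> K \<subseteq> Fin ` Z \<Longrightarrow> uniform_limit K (\<lambda>n x. M (h (r n) (fin_part x))) l sequentially"
        using bounded_sphere_subsequence[OF BZ(2), of h B M] hY[OF hYn] BZ(5)[OF hYn] M by blast
      have "uniform_limit K (\<lambda>n. f ((s \<circ> r) n)) l sequentially" if K: "compact K \<and> K \<subseteq> Fin ` Z" for K
      proof -
        have "f ((s \<circ> r) n) x = M (h (r n) (fin_part x))" if "x \<in> K" for n x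
          using that K eq by (auto simp: q(2))
        thus ?thesis using rl(2)[OF K] by (subst uniform_limit_cong') auto
      qed
      thus ?thesis using strict_mono_o[OF s rl(1)] by blast
    qed
    show "\<exists>r l. strict_mono (r :: nat \<Rightarrow> nat) \<and>
        (\<forall>K. compact K \<and> K \<subseteq> Fin ` Z \<longrightarrow> uniform_limit K (\<lambda>n. f (r n)) l sequentially)"
    proof (cases "infinite I")
      case True
      then obtain s where s: "strict_mono (s :: nat \<Rightarrow> nat)" "\<And>n. s n \<in> I"
        using infinite_enumerate by blast
      show ?thesis
      proof (rule key[OF s(1), of "\<lambda>n. nf (q (s n))" "\<lambda>\<zeta>. Fin (a + (b - a) * \<zeta>)"])
        show "nf (q (s n)) \<in> Y" for n
          using s(2)[of n] q(1) by (auto simp: Y_def X_def I_def)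
        show "Fin (poly (q (s n)) z) = Fin (a + (b - a) * nf (q (s n)) z)" for n z
          using ab by (simp add: nf_def)
      qed (intro continuous_intros)
    next
      case False
      hence "infinite (- I)" by (simp add: finite_compl)
      then obtain s where s: "strict_mono (s :: nat \<Rightarrow> nat)" "\<And>n. s n \<in> - I"
        using infinite_enumerate by blast
      show ?thesis
      proof (rule key[OF s(1), of "\<lambda>n z. inverse (nf (q (s n)) z)"
            "\<lambda>\<zeta>. if \<zeta> = 0 then Infty else Fin (a + (b - a) / \<zeta>)"])
        show "(\<lambda>z. inverse (nf (q (s n)) z)) \<in> Y" for n
          using s(2)[of n] q(1) by (auto simp: Y_def X_def I_def norm_inverse intro!: inverse_le_1_iff[THEN iffD2])
        show "Fin (poly (q (s n)) z) = (if inverse (nf (q (s n)) z) = 0 then Infty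
            else Fin (a + (b - a) / inverse (nf (q (s n)) z)))" if "z \<in> Z" for n z
          using ab nf(1)[OF q(1), of z "s n"] BZ(4) that by (auto simp: nf_def)
        show "continuous_on UNIV (\<lambda>\<zeta>. if \<zeta> = 0 then Infty else Fin (a + (b - a) / \<zeta>))"
          using ab by (intro continuous_on_moebius_sphere) auto
      qed
    qed
  qed
  thus ?thesis using open_Fin_image[OF BZ(2)] BZ(3) by blast
qed

subsection \<open>Fatou and Julia sets of finitely generated polynomial semigroups\<close>

lemma sphere_poly_pcompose: "sphere_poly (pcompose p q) = sphere_poly p \<circ> sphere_poly q"
proof
  show "sphere_poly (pcompose p q) x = (sphere_poly p \<circ> sphere_poly q) x" for x
    by (cases x) (auto simp: poly_pcompose)
qed

lemma inj_sphere_poly: "sphere_poly p = sphere_poly q \<Longrightarrow> p = q"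
  by (metis poly_eq_poly_eq_iff ext riemann_sphere.inject sphere_poly.simps(1))

lemma semigroup_generated_mono: "H \<subseteq> H' \<Longrightarrow> semigroup_generated H \<subseteq> semigroup_generated H'"
proof
  fix g assume "H \<subseteq> H'" "g \<in> semigroup_generated H"
  from this(2,1) show "g \<in> semigroup_generated H'"
    by induction (auto intro: semigroup_generated.intros)
qed

lemma semigroup_generated_sphere_poly:
  assumes "g \<in> semigroup_generated (sphere_poly ` P)"
  shows "g \<in> range sphere_poly"
  using assms
proof induction
  case (comp f g)
  then obtain p q where "f = sphere_poly p" "g = sphere_poly q" by (elim rangeE)
  hence "f \<circ> g = sphere_poly (pcompose p q)" by (simp only: sphere_poly_pcompose)
  thus ?case by (rule range_eqI)
qed auto

lemma open_fatou_set: "open (fatou_set G)"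
proof -
  have "fatou_set G = \<Union> {U. open U \<and> normal_on G U}"
    by (auto simp: fatou_set_def)
  thus ?thesis by (auto intro: open_Union)
qed

lemma closed_julia_set: "closed (julia_set G)"
  by (simp add: julia_set_def open_fatou_set closed_Compl)

lemma julia_set_mono: "G' \<subseteq> G \<Longrightarrow> julia_set G' \<subseteq> julia_set G"
  unfolding julia_set_def fatou_set_def using normal_on_subset by blast

text \<open>Composition trees of depth at most \<open>N\<close> rather than words of bounded length:
  this matches the binary rule generating the semigroup, and there are still only finitely many over
  a finite \<open>P\<close>.\<close>

fun words_upto :: "complex poly set \<Rightarrow> nat \<Rightarrow> complex poly set" where
  "words_upto P 0 = P"
| "words_upto P (Suc N) = words_upto P N \<union> (\<lambda>(f, g). pcompose f g) ` (words_upto P N \<times> words_upto P N)"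

lemma finite_words_upto: "finite P \<Longrightarrow> finite (words_upto P N)"
  by (induction N) auto

text \<open>If a composition is not a tree of depth \<open>N\<close>, one of its factors is not a
  tree of depth \<open>N - 1\<close>. That factor contributes growth \<open>2 ^ (N - 1)\<close>, and
  the escape radius of the other contributes the missing two.\<close>

lemma semigroup_escape:
  assumes esc: "\<And>p. p \<in> P \<Longrightarrow> escape_radius p R"
    and g: "g \<in> semigroup_generated (sphere_poly ` P)"
  shows "\<exists>q. g = sphere_poly q \<and> escape_radius q R \<and>
    (\<forall>N. q \<in> words_upto P N \<or> (\<forall>z. norm z > R \<longrightarrow> norm (poly q z) \<ge> 2 ^ N * norm z))"
  using g
proof induction
  case (gen h)
  then obtain p where p: "h = sphere_poly p" "p \<in> P" by auto
  have "p \<in> words_upto P N" for N by (induction N) (use p in auto)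
  thus ?case using p esc by blast
next
  case (comp f g)
  then obtain a b where
    a: "f = sphere_poly a" "escape_radius a R"
      "\<And>N. a \<in> words_upto P N \<or> (\<forall>z. norm z > R \<longrightarrow> norm (poly a z) \<ge> 2 ^ N * norm z)" and
    b: "g = sphere_poly b" "escape_radius b R"
      "\<And>N. b \<in> words_upto P N \<or> (\<forall>z. norm z > R \<longrightarrow> norm (poly b z) \<ge> 2 ^ N * norm z)" by blast
  have R: "R > 0" using a(2) by (simp add: escape_radius_def)
  have az: "norm (poly a z) \<ge> 2 * norm z" and bz: "norm (poly b z) \<ge> 2 * norm z" if "norm z > R" for z
    using a(2) b(2) that by (auto simp: escape_radius_def)
  have bR: "norm (poly b z) > R" if "norm z > R" for z using bz[OF that] that R by linarith
  have ab: "norm (poly a (poly b z)) \<ge> 2 * norm z" if "norm z > R" for z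
    using az[OF bR[OF that]] bz[OF that] that R by linarith
  have "pcompose a b \<in> words_upto P N \<or>
      (\<forall>z. norm z > R \<longrightarrow> norm (poly (pcompose a b) z) \<ge> 2 ^ N * norm z)" for N
  proof (cases N)
    case 0
    have "norm z \<le> norm (poly a (poly b z))" if "norm z > R" for z
      using ab[OF that] norm_ge_zero[of z] by linarith
    thus ?thesis using 0 by (auto simp: poly_pcompose)
  next
    case (Suc M)
    show ?thesis
    proof (cases "a \<in> words_upto P M \<and> b \<in> words_upto P M")
      case True
      thus ?thesis using Suc by auto
    next
      case False
      have "norm (poly a (poly b z)) \<ge> 2 ^ N * norm z" if z: "norm z > R" for z
      proof (cases "a \<in> words_upto P M")
        case True
        hence "norm (poly b z) \<ge> 2 ^ M * norm z" using b(3)[of M] False z by blast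
        thus ?thesis using az[OF bR[OF z]] Suc by simp
      next
        case False
        hence "norm (poly a (poly b z)) \<ge> 2 ^ M * norm (poly b z)" using a(3)[of M] bR[OF z] by blast
        moreover have "2 ^ M * norm (poly b z) \<ge> 2 ^ M * (2 * norm z)"
          using bz[OF z] by (intro mult_left_mono) auto
        moreover have "2 ^ N * norm z = 2 ^ M * (2 * norm z)" using Suc by simp
        ultimately show ?thesis by linarith
      qed
      thus ?thesis by (auto simp: poly_pcompose)
    qed
  qed
  moreover have "escape_radius (pcompose a b) R"
    using R ab by (simp add: escape_radius_def poly_pcompose)
  ultimately show ?case
    using a(1) b(1) by (intro exI[of _ "pcompose a b"]) (auto simp: sphere_poly_pcompose)
qed

lemma common_escape_radius:
  assumes "finite P" "\<And>p. p \<in> P \<Longrightarrow> degree p \<ge> 2"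
  shows "\<exists>R\<ge>R0. R > 0 \<and> (\<forall>p\<in>P. escape_radius p R)"
  using assms
proof (induction P)
  case empty
  show ?case by (intro exI[of _ "max 1 R0"]) auto
next
  case (insert p P)
  then obtain R where R: "R \<ge> R0" "R > 0" "\<And>p. p \<in> P \<Longrightarrow> escape_radius p R" by auto
  obtain R' where R': "escape_radius p R'" by (rule escape_radius_exists[of p]) (use insert.prems in auto)
  show ?case
    using R escape_radius_mono[OF R'] escape_radius_mono[OF R(3)]
    by (intro exI[of _ "max R R'"]) auto
qed

text \<open>In a sequence of elements, either one element recurs infinitely often, or the word lengths
  tend to infinity and with them the growth outside the escape radius.\<close>

lemma normal_at_Infty:
  assumes P: "finite P" "\<And>p. p \<in> P \<Longrightarrow> degree p \<ge> 2"
  shows "\<exists>R. normal_on (semigroup_generated (sphere_poly ` P)) (insert Infty (Fin ` {z. norm z > R}))"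
proof -
  obtain R where R: "R > 0" "\<And>p. p \<in> P \<Longrightarrow> escape_radius p R"
    using common_escape_radius[OF P, of 0] by blast
  let ?U = "insert Infty (Fin ` {z. norm z > R})"
  have "normal_on (semigroup_generated (sphere_poly ` P)) ?U"
    unfolding normal_on_def
  proof (intro allI impI)
    fix f :: "nat \<Rightarrow> riemann_sphere \<Rightarrow> riemann_sphere"
    assume f: "range f \<subseteq> semigroup_generated (sphere_poly ` P)"
    have "\<forall>n. \<exists>q. f n = sphere_poly q \<and>
        (\<forall>N. q \<in> words_upto P N \<or> (\<forall>z. norm z > R \<longrightarrow> norm (poly q z) \<ge> 2 ^ N * norm z))"
    proof
      fix n
      have "f n \<in> semigroup_generated (sphere_poly ` P)" using f by auto
      from semigroup_escape[OF R(2) this] show "\<exists>q. f n = sphere_poly q \<and>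
        (\<forall>N. q \<in> words_upto P N \<or> (\<forall>z. norm z > R \<longrightarrow> norm (poly q z) \<ge> 2 ^ N * norm z))"
        by auto
    qed
    from choice[OF this] obtain q where q: "\<And>n. f n = sphere_poly (q n)"
      "\<And>n N. q n \<in> words_upto P N \<or> (\<forall>z. norm z > R \<longrightarrow> norm (poly (q n) z) \<ge> 2 ^ N * norm z)"
      by auto
    show "\<exists>r l. strict_mono (r :: nat \<Rightarrow> nat) \<and>
        (\<forall>K. compact K \<and> K \<subseteq> ?U \<longrightarrow> uniform_limit K (\<lambda>n. f (r n)) l sequentially)"
    proof (cases "\<exists>p. infinite {n. q n = p}")
      case True
      then obtain p where "infinite {n. q n = p}" by blast
      then obtain r where r: "strict_mono (r :: nat \<Rightarrow> nat)" "\<And>n. r n \<in> {n. q n = p}"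
        using infinite_enumerate by blast
      hence "f (r n) = sphere_poly p" for n using q(1) by auto
      thus ?thesis using r(1) by (intro exI[of _ r] exI[of _ "sphere_poly p"]) (auto simp: uniform_limit_iff)
    next
      case False
      \<comment> \<open>No element recurs infinitely often, so for each \<open>N\<close> the
        sequence eventually leaves the finite set \<open>words_upto P N\<close> and then expands by
        \<open>2 ^ N\<close> beyond radius \<open>R\<close>.\<close>
      have "uniform_limit ?U f (\<lambda>_. Infty) sequentially"
      proof (rule uniform_limitI)
        fix e :: real assume "e > 0"
        have "((\<lambda>z. Fin z) \<longlongrightarrow> Infty) at_infinity"
          by (rule tendsto_Fin_Infty) (rule filterlim_ident)
        hence "eventually (\<lambda>z. dist (Fin z) Infty < e) at_infinity"
          using \<open>e > 0\<close> by (rule tendstoD)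
        then obtain b where b: "\<And>z. norm z \<ge> b \<Longrightarrow> dist (Fin z) Infty < e"
          by (auto simp: eventually_at_infinity)
        obtain N where N: "b / R < 2 ^ N" using real_arch_pow[of 2 "b / R"] by auto
        have "{n. q n \<in> words_upto P N} = (\<Union>p\<in>words_upto P N. {n. q n = p})" by auto
        hence "finite {n. q n \<in> words_upto P N}"
          using False finite_words_upto[OF P(1), of N] by simp
        hence "eventually (\<lambda>n. q n \<notin> words_upto P N) sequentially"
          by (simp add: cofinite_eq_sequentially[symmetric] eventually_cofinite)
        thus "\<forall>\<^sub>F n in sequentially. \<forall>x\<in>?U. dist (f n x) Infty < e"
        proof eventually_elim
          case (elim n)
          have "dist (Fin (poly (q n) z)) Infty < e" if z: "norm z > R" for z
          proof (rule b)
            have "b < 2 ^ N * R" using N R(1) by (simp add: field_simps)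
            also have "\<dots> \<le> 2 ^ N * norm z" using z by (intro mult_left_mono) auto
            also have "\<dots> \<le> norm (poly (q n) z)" using q(2)[of n N] elim z by blast
            finally show "b \<le> norm (poly (q n) z)" by simp
          qed
          thus ?case using \<open>e > 0\<close> by (auto simp: q(1))
        qed
      qed
      hence "uniform_limit K (\<lambda>n. f (id n)) (\<lambda>_. Infty) sequentially" if "K \<subseteq> ?U" for K
        using uniform_limit_on_subset[OF _ that] by simp
      thus ?thesis by (intro exI[of _ id] exI[of _ "\<lambda>_. Infty"]) (auto simp: strict_mono_def)
    qed
  qed
  thus ?thesis by blast
qed

text \<open>A neighbourhood of \<open>Infty\<close> lies in the Fatou set. From here on the Julia
  set can be studied as a compact subset of the plane.\<close>

lemma julia_set_subset_range_Fin:
  assumes "finite P" "\<And>p. p \<in> P \<Longrightarrow> degree p \<ge> 2"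
  shows "julia_set (semigroup_generated (sphere_poly ` P)) \<subseteq> range Fin"
    and "compact (Fin -` julia_set (semigroup_generated (sphere_poly ` P)))"
proof -
  let ?G = "semigroup_generated (sphere_poly ` P)"
  obtain R where R: "normal_on ?G (insert Infty (Fin ` {z. norm z > R}))"
    using normal_at_Infty[OF assms] by blast
  hence sub: "insert Infty (Fin ` {z. norm z > R}) \<subseteq> fatou_set ?G"
    using open_Infty_nbhd[of R] by (auto simp: fatou_set_def)
  thus "julia_set ?G \<subseteq> range Fin" by (auto simp: julia_set_def range_Fin)
  have "closed (Fin -` julia_set ?G)"
    using continuous_on_closed_vimage[OF closed_UNIV, of Fin] continuous_on_Fin[OF continuous_on_id]
      closed_julia_set by simp
  moreover have "Fin -` julia_set ?G \<subseteq> cball 0 R"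
    using sub by (force simp: julia_set_def)
  ultimately show "compact (Fin -` julia_set ?G)"
    using bounded_subset[OF bounded_cball] by (auto simp: compact_eq_bounded_closed)
qed

text \<open>Backward invariance passes from the generators to all elements, so on a disc missing
  \<open>X\<close> no element takes a value in \<open>X\<close>. Two points of \<open>X\<close>,
  together with \<open>Infty\<close>, are then three omitted values.\<close>

lemma julia_set_subset_backward_invariant:
  assumes P: "finite P" "\<And>p. p \<in> P \<Longrightarrow> degree p \<ge> 2"
    and X: "closed X" "\<exists>a\<in>X. \<exists>b\<in>X. a \<noteq> b"
    and inv: "\<And>p. p \<in> P \<Longrightarrow> poly p -` X \<subseteq> X"
  shows "julia_set (semigroup_generated (sphere_poly ` P)) \<subseteq> Fin ` X"
proof
  let ?G = "semigroup_generated (sphere_poly ` P)"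
  fix x assume x: "x \<in> julia_set ?G"
  then obtain w where w: "x = Fin w" using julia_set_subset_range_Fin(1)[OF P] by blast
  define Q where "Q = {q. sphere_poly q \<in> ?G}"
  have "g \<in> sphere_poly ` Q" if "g \<in> ?G" for g
    using that semigroup_generated_sphere_poly[OF that] by (auto simp: Q_def)
  hence GQ: "?G = sphere_poly ` Q" by (auto simp: Q_def)
  have Qinv: "sphere_poly q -` Fin ` X \<subseteq> Fin ` X" if "sphere_poly q \<in> ?G" for q
  proof -
    have "g -` Fin ` X \<subseteq> Fin ` X" if "g \<in> ?G" for g
      using that
    proof induction
      case (gen h)
      then obtain p where p: "h = sphere_poly p" "p \<in> P" by blast
      show ?case
      proof
        fix y assume "y \<in> h -` Fin ` X"
        thus "y \<in> Fin ` X" using inv[OF p(2)] p(1) by (cases y) auto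
      qed
    next
      case (comp f g)
      have "g -` (f -` Fin ` X) \<subseteq> g -` (Fin ` X)" using comp by (intro vimage_mono)
      also have "\<dots> \<subseteq> Fin ` X" using comp by simp
      finally show ?case by (simp only: vimage_comp)
    qed
    thus ?thesis using that .
  qed
  show "x \<in> Fin ` X"
  proof (rule ccontr)
    assume "x \<notin> Fin ` X"
    hence "w \<in> - X" using w by auto
    then obtain e where e: "e > 0" "ball w e \<subseteq> - X"
      using X(1) open_contains_ball[of "- X"] by (auto simp: open_Compl)
    obtain a b where ab: "a \<in> X" "b \<in> X" "a \<noteq> b" using X(2) by blast
    have "\<exists>U. open U \<and> Fin w \<in> U \<and> normal_on (sphere_poly ` Q) U"
    proof (rule normal_omitting_two_values[OF ab(3) e(1)])
      fix q z assume q: "q \<in> Q" and z: "z \<in> ball w e"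
      have "poly q z \<notin> X"
      proof
        assume "poly q z \<in> X"
        hence "Fin z \<in> sphere_poly q -` Fin ` X" by simp
        moreover have "sphere_poly q -` Fin ` X \<subseteq> Fin ` X" using q by (intro Qinv) (simp add: Q_def)
        ultimately have "Fin z \<in> Fin ` X" by (rule rev_subsetD)
        hence "z \<in> X" by auto
        thus False using z e(2) by auto
      qed
      thus "poly q z \<noteq> a \<and> poly q z \<noteq> b" using ab by auto
    qed
    hence "x \<in> fatou_set ?G" using w GQ by (auto simp: fatou_set_def)
    thus False using x by (simp add: julia_set_def)
  qed
qed

text \<open>Normality at \<open>z\<close> is pushed forward to \<open>poly q z\<close>: precompose a
  sequence with \<open>g\<close>, extract a limit near \<open>z\<close>, and transport it to the
  image, which is open.\<close>

lemma julia_set_vimage: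
  assumes g: "g \<in> semigroup_generated (sphere_poly ` P)" "g = sphere_poly q" "degree q \<ge> 1"
    and z: "Fin (poly q z) \<in> julia_set (semigroup_generated (sphere_poly ` P))"
  shows "Fin z \<in> julia_set (semigroup_generated (sphere_poly ` P))"
proof (rule ccontr)
  let ?G = "semigroup_generated (sphere_poly ` P)"
  assume "Fin z \<notin> julia_set ?G"
  then obtain U where U: "open U" "Fin z \<in> U" "normal_on ?G U"
    by (auto simp: julia_set_def fatou_set_def)
  have oU: "open (Fin -` U)"
    using U(1) continuous_on_open_vimage[OF open_UNIV, of Fin] continuous_on_Fin[OF continuous_on_id] by simp
  obtain d where d: "d > 0" "cball z d \<subseteq> Fin -` U"
    using open_contains_cball_eq[OF oU] U(2) by (metis vimageI2)
  define V where "V = Fin ` poly q ` ball z d"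
  have "open V" unfolding V_def by (intro open_Fin_image open_poly_image g open_ball)
  moreover have "Fin (poly q z) \<in> V" using d(1) by (auto simp: V_def)
  moreover have "normal_on ?G V"
    unfolding normal_on_def
  proof (intro allI impI)
    fix f :: "nat \<Rightarrow> riemann_sphere \<Rightarrow> riemann_sphere"
    assume f: "range f \<subseteq> ?G"
    hence "range (\<lambda>n. f n \<circ> g) \<subseteq> ?G" using g(1) by (auto intro: semigroup_generated.comp)
    from U(3)[unfolded normal_on_def, rule_format, OF this]
    obtain r l where r: "strict_mono (r :: nat \<Rightarrow> nat)" and
      "\<And>K. compact K \<and> K \<subseteq> U \<Longrightarrow> uniform_limit K (\<lambda>n. f (r n) \<circ> g) l sequentially"
      by auto
    moreover have "compact (Fin ` cball z d)" "Fin ` cball z d \<subseteq> U"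
      using d by (auto intro: compact_Fin_image)
    ultimately have lim: "uniform_limit (Fin ` cball z d) (\<lambda>n. f (r n) \<circ> g) l sequentially"
      by blast
    \<comment> \<open>An arbitrary right inverse of \<open>g\<close>; uniform convergence can be
      transported along it whether or not it is continuous.\<close>
    define s where "s = inv_into (Fin ` cball z d) g"
    have s: "s y \<in> Fin ` cball z d" "g (s y) = y" if "y \<in> V" for y
    proof -
      have "y \<in> g ` Fin ` cball z d" using that g(2) by (force simp: V_def)
      thus "s y \<in> Fin ` cball z d" "g (s y) = y"
        unfolding s_def by (rule inv_into_into, rule f_inv_into_f)
    qed
    have "uniform_limit V (\<lambda>n y. (f (r n) \<circ> g) (s y)) (\<lambda>y. l (s y)) sequentially"
      by (rule uniform_limit_compose'[OF lim]) (use s in auto)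
    hence "uniform_limit V (\<lambda>n. f (r n)) (\<lambda>y. l (s y)) sequentially"
      by (subst (asm) uniform_limit_cong') (use s in auto)
    thus "\<exists>r l. strict_mono (r :: nat \<Rightarrow> nat) \<and>
        (\<forall>K. compact K \<and> K \<subseteq> V \<longrightarrow> uniform_limit K (\<lambda>n. f (r n)) l sequentially)"
      using r uniform_limit_on_subset[where J = V] by (intro exI[of _ r] exI[of _ "\<lambda>y. l (s y)"]) auto
  qed
  ultimately have "Fin (poly q z) \<in> fatou_set ?G" by (auto simp: fatou_set_def)
  thus False using z by (simp add: julia_set_def)
qed

section \<open>Iteration of a single polynomial\<close>

lemma funpow_sphere_poly: "(sphere_poly p ^^ n) (Fin z) = Fin ((poly p ^^ n) z)"
  by (induction n) auto

lemma funpow_Suc_in_semigroup: "h \<in> H \<Longrightarrow> h ^^ Suc n \<in> semigroup_generated H"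
proof (induction n)
  case (Suc n)
  hence "h \<circ> h ^^ Suc n \<in> semigroup_generated H"
    by (intro semigroup_generated.comp[OF semigroup_generated.gen])
  thus ?case by (simp only: funpow.simps)
qed (auto intro: semigroup_generated.gen)

lemma iterates_at_infinity:
  assumes p: "degree p \<ge> 2" and y: "y \<notin> filled_julia p"
  shows "filterlim (\<lambda>n. (poly p ^^ n) y) at_infinity sequentially"
proof -
  obtain R where R: "escape_radius p R" using escape_radius_exists[OF p] by metis
  then obtain k where k: "norm ((poly p ^^ k) y) > R"
    using y filled_julia_eq[OF R] by (auto simp: not_le)
  have R0: "R > 0" using R by (simp add: escape_radius_def)
  \<comment> \<open>Chosen so that \<open>c * 2 ^ n\<close> equals \<open>2 ^ (n - k)\<close> times
    the norm of the \<open>k\<close>-th iterate, the lower bound after escape.\<close>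
  define c where "c = norm ((poly p ^^ k) y) / 2 ^ k"
  have "norm ((poly p ^^ k) y) > 0" using k R0 by linarith
  hence c: "c > 0" by (simp add: c_def)
  have "filterlim (\<lambda>n. c * real n) at_top sequentially"
    using c by (intro filterlim_tendsto_pos_mult_at_top[OF tendsto_const] filterlim_real_sequentially)
  hence "filterlim (\<lambda>n. norm ((poly p ^^ n) y)) at_top sequentially"
  proof (rule filterlim_at_top_mono)
    have "c * real n \<le> norm ((poly p ^^ n) y)" if "n \<ge> k" for n
    proof -
      have "real n \<le> 2 ^ n" using of_nat_less_two_power[of n, where ?'a = real] by linarith
      hence "c * real n \<le> c * 2 ^ n" using c by (intro mult_left_mono) auto
      also have "\<dots> = 2 ^ (n - k) * norm ((poly p ^^ k) y)"
        using that by (simp add: c_def power_diff field_simps)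
      also have "\<dots> \<le> norm ((poly p ^^ (n - k)) ((poly p ^^ k) y))" by (rule escape_funpow[OF R k])
      also have "(poly p ^^ (n - k)) ((poly p ^^ k) y) = (poly p ^^ n) y"
        using that funpow_add[of "n - k" k "poly p"] by simp
      finally show ?thesis .
    qed
    thus "\<forall>\<^sub>F n in sequentially. c * real n \<le> norm ((poly p ^^ n) y)"
      by (rule eventually_sequentiallyI)
  qed
  thus ?thesis by (simp add: filterlim_at_infinity_conv_norm_at_top)
qed

text \<open>The exponents carry \<open>Suc\<close> because the semigroup is generated without the
  identity. The sequence \<open>k\<close> is arbitrary, so exponents chosen later, even non-monotone
  ones, are covered.\<close>

lemma iterates_normal_plane:
  assumes "Fin w \<in> fatou_set (semigroup_generated {sphere_poly p})"
  obtains d where "d > 0"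
    "\<And>k :: nat \<Rightarrow> nat. \<exists>r l. strict_mono (r :: nat \<Rightarrow> nat) \<and> continuous_on (cball w d) l \<and>
       uniform_limit (cball w d) (\<lambda>n z. Fin ((poly p ^^ Suc (k (r n))) z)) l sequentially"
proof -
  obtain U where U: "open U" "Fin w \<in> U" "normal_on (semigroup_generated {sphere_poly p}) U"
    using assms by (auto simp: fatou_set_def)
  have oU: "open (Fin -` U)"
    using U(1) continuous_on_open_vimage[OF open_UNIV, of Fin] continuous_on_Fin[OF continuous_on_id] by simp
  obtain d where d: "d > 0" "cball w d \<subseteq> Fin -` U"
    using open_contains_cball_eq[OF oU] U(2) by (metis vimageI2)
  have "\<exists>r l. strict_mono (r :: nat \<Rightarrow> nat) \<and> continuous_on (cball w d) l \<and>
       uniform_limit (cball w d) (\<lambda>n z. Fin ((poly p ^^ Suc (k (r n))) z)) l sequentially"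
    for k :: "nat \<Rightarrow> nat"
  proof -
    have "range (\<lambda>n. sphere_poly p ^^ Suc (k n)) \<subseteq> semigroup_generated {sphere_poly p}"
      by (intro image_subsetI funpow_Suc_in_semigroup) simp
    from U(3)[unfolded normal_on_def, rule_format, OF this]
    obtain r l where r: "strict_mono (r :: nat \<Rightarrow> nat)" and
      "\<And>K. compact K \<and> K \<subseteq> U \<Longrightarrow> uniform_limit K (\<lambda>n. sphere_poly p ^^ Suc (k (r n))) l sequentially"
      by auto
    moreover have "compact (Fin ` cball w d)" "Fin ` cball w d \<subseteq> U"
      using d by (auto intro: compact_Fin_image)
    ultimately have "uniform_limit (Fin ` cball w d) (\<lambda>n. sphere_poly p ^^ Suc (k (r n))) l sequentially"
      by blast
    hence "uniform_limit (cball w d) (\<lambda>n z. (sphere_poly p ^^ Suc (k (r n))) (Fin z)) (\<lambda>z. l (Fin z)) sequentially"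
      by (rule uniform_limit_compose') auto
    hence lim: "uniform_limit (cball w d) (\<lambda>n z. Fin ((poly p ^^ Suc (k (r n))) z)) (\<lambda>z. l (Fin z)) sequentially"
      by (simp only: funpow_sphere_poly)
    have "continuous_on (cball w d) (\<lambda>z. Fin ((poly p ^^ Suc (k (r n))) z))" for n
      unfolding poly_poly_iterate[symmetric] by (intro continuous_intros)
    hence "continuous_on (cball w d) (\<lambda>z. l (Fin z))"
      by (intro uniform_limit_theorem[OF _ lim]) auto
    with r lim show ?thesis by blast
  qed
  with d(1) show ?thesis by (rule that)
qed

text \<open>The frontier of the filled Julia set is backward invariant with two points, which bounds
  the Julia set from above. At a frontier point normality fails: a continuous limit would be
  \<open>Infty\<close> on nearby escaping points, hence at the point itself, whose orbit stays
  bounded.\<close>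

lemma julia_sphere_poly:
  assumes p: "degree p \<ge> 2"
  shows "julia (sphere_poly p) = Fin ` frontier (filled_julia p)"
proof
  let ?K = "filled_julia p"
  have "julia_set (semigroup_generated (sphere_poly ` {p})) \<subseteq> Fin ` frontier ?K"
  proof (rule julia_set_subset_backward_invariant)
    show "poly q -` frontier ?K \<subseteq> frontier ?K" if "q \<in> {p}" for q
      using that p by (simp add: poly_vimage_frontier[symmetric] vimage_filled_julia)
  qed (use p frontier_filled_julia_two_points[OF p] frontier_closed in auto)
  thus "julia (sphere_poly p) \<subseteq> Fin ` frontier ?K" by simp
  show "Fin ` frontier ?K \<subseteq> julia (sphere_poly p)"
  proof (rule image_subsetI, rule ccontr)
    fix w assume w: "w \<in> frontier ?K" "Fin w \<notin> julia (sphere_poly p)"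
    have "Fin w \<in> fatou_set (semigroup_generated {sphere_poly p})"
      using w(2) by (simp add: julia_set_def)
    then obtain d where d: "d > 0"
      "\<And>k :: nat \<Rightarrow> nat. \<exists>r l. strict_mono (r :: nat \<Rightarrow> nat) \<and> continuous_on (cball w d) l \<and>
       uniform_limit (cball w d) (\<lambda>n z. Fin ((poly p ^^ Suc (k (r n))) z)) l sequentially"
      by (rule iterates_normal_plane) (rule that)
    obtain r l where r: "strict_mono (r :: nat \<Rightarrow> nat)" and l: "continuous_on (cball w d) l"
      and lim: "uniform_limit (cball w d) (\<lambda>n z. Fin ((poly p ^^ Suc (r n)) z)) l sequentially"
      using d(2)[of id] by auto
    define T where "T = {z \<in> cball w d. l z = Infty}"
    have "closed T" unfolding T_def
      by (rule continuous_closed_preimage_constant[OF l closed_cball])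
    have "ball w d \<inter> - ?K \<subseteq> T"
    proof
      fix y assume y: "y \<in> ball w d \<inter> - ?K"
      have "filterlim (\<lambda>n. Suc (r n)) sequentially sequentially"
        using r by (intro filterlim_subseq) (auto simp: strict_mono_def)
      hence "filterlim (\<lambda>n. (poly p ^^ Suc (r n)) y) at_infinity sequentially"
        using filterlim_compose[OF iterates_at_infinity[OF p]] y by blast
      hence "(\<lambda>n. Fin ((poly p ^^ Suc (r n)) y)) \<longlonglongrightarrow> Infty" by (rule tendsto_Fin_Infty)
      moreover have "(\<lambda>n. Fin ((poly p ^^ Suc (r n)) y)) \<longlonglongrightarrow> l y"
        using y by (intro tendsto_uniform_limitI[OF lim]) auto
      ultimately have "l y = Infty" by (rule LIMSEQ_unique[rotated])
      thus "y \<in> T" using y by (auto simp: T_def)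
    qed
    hence "closure (ball w d \<inter> - ?K) \<subseteq> T" using \<open>closed T\<close> by (rule closure_minimal)
    moreover have "w \<in> ball w d \<inter> closure (- ?K)"
      using w(1) d(1) by (auto simp: frontier_closures)
    hence "w \<in> closure (ball w d \<inter> - ?K)" using open_Int_closure_subset[OF open_ball] by blast
    ultimately have lw: "l w = Infty" by (auto simp: T_def)
    obtain R where R: "escape_radius p R" using escape_radius_exists[OF p] by metis
    have "w \<in> ?K" using w(1) frontier_subset_closed compact_imp_closed[OF compact_filled_julia[OF p]] by blast
    hence "norm ((poly p ^^ n) w) \<le> R" for n using filled_julia_eq[OF R] by auto
    hence "Fin ((poly p ^^ Suc (r n)) w) \<in> Fin ` cball 0 R" for n
      by (intro imageI) (simp only: mem_cball_0)
    moreover have "closed (Fin ` cball 0 R)" by (intro compact_imp_closed compact_Fin_image compact_cball)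
    moreover have "(\<lambda>n. Fin ((poly p ^^ Suc (r n)) w)) \<longlonglongrightarrow> l w"
      using d(1) by (intro tendsto_uniform_limitI[OF lim]) auto
    ultimately have "l w \<in> Fin ` cball 0 R"
      by (intro Lim_in_closed_set[of _ "\<lambda>n. Fin ((poly p ^^ Suc (r n)) w)" sequentially]) auto
    thus False using lw by auto
  qed
qed

text \<open>Normality used as equicontinuity, uniformly in the exponent. A counterexample yields
  \<open>z k\<close> tending to \<open>w\<close> with iterates in \<open>A\<close>. A uniform limit
  at \<open>w\<close> then lies in \<open>A\<close>, so iterates of \<open>w\<close> itself enter
  the neighbourhood \<open>O'\<close>.\<close>

lemma fatou_iterates_near:
  assumes w: "Fin w \<notin> julia (sphere_poly p)" and A: "compact A" and O': "open O'" "A \<subseteq> O'"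
  shows "\<exists>e>0. \<exists>N. \<forall>n\<ge>N. \<forall>z\<in>ball w e. (poly p ^^ n) z \<in> A \<longrightarrow> (poly p ^^ n) w \<in> O'"
proof (rule ccontr)
  assume contra: "\<not> ?thesis"
  have "\<forall>k. \<exists>mz. snd mz \<in> ball w (inverse (real (Suc k))) \<and> (poly p ^^ Suc (fst mz)) (snd mz) \<in> A \<and>
      (poly p ^^ Suc (fst mz)) w \<notin> O'"
  proof
    fix k
    have "inverse (real (Suc k)) > 0" by simp
    with contra have "\<not> (\<forall>n\<ge>Suc k. \<forall>z\<in>ball w (inverse (real (Suc k))). (poly p ^^ n) z \<in> A \<longrightarrow> (poly p ^^ n) w \<in> O')"
      by blast
    then obtain n z where nz: "n \<ge> Suc k" "z \<in> ball w (inverse (real (Suc k)))"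
      "(poly p ^^ n) z \<in> A" "(poly p ^^ n) w \<notin> O'" by blast
    \<comment> \<open>Taking \<open>n\<close> at least \<open>Suc k\<close> keeps the exponent
      positive, as \<open>iterates_normal_plane\<close> requires.\<close>
    have "Suc (n - 1) = n" using nz(1) by simp
    thus "\<exists>mz. snd mz \<in> ball w (inverse (real (Suc k))) \<and> (poly p ^^ Suc (fst mz)) (snd mz) \<in> A \<and>
      (poly p ^^ Suc (fst mz)) w \<notin> O'"
      using nz by (intro exI[of _ "(n - 1, z)"]) (simp only: fst_conv snd_conv simp_thms)
  qed
  from choice[OF this] obtain mz where "\<forall>k. snd (mz k) \<in> ball w (inverse (real (Suc k))) \<and>
      (poly p ^^ Suc (fst (mz k))) (snd (mz k)) \<in> A \<and> (poly p ^^ Suc (fst (mz k))) w \<notin> O'" ..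
  moreover define m where "m k = fst (mz k)" for k
  moreover define z where "z k = snd (mz k)" for k
  ultimately have mz: "\<And>k. z k \<in> ball w (inverse (real (Suc k)))"
    "\<And>k. (poly p ^^ Suc (m k)) (z k) \<in> A" "\<And>k. (poly p ^^ Suc (m k)) w \<notin> O'"
    by simp_all
  have "Fin w \<in> fatou_set (semigroup_generated {sphere_poly p})"
    using w by (simp add: julia_set_def)
  then obtain d where d: "d > 0"
      "\<And>k :: nat \<Rightarrow> nat. \<exists>r l. strict_mono (r :: nat \<Rightarrow> nat) \<and> continuous_on (cball w d) l \<and>
       uniform_limit (cball w d) (\<lambda>n z. Fin ((poly p ^^ Suc (k (r n))) z)) l sequentially"
    by (rule iterates_normal_plane) (rule that)
  obtain r l where r: "strict_mono (r :: nat \<Rightarrow> nat)" and l: "continuous_on (cball w d) l"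
      and lim: "uniform_limit (cball w d) (\<lambda>n z. Fin ((poly p ^^ Suc (m (r n))) z)) l sequentially"
    using d(2)[of m] by auto
  have "(\<lambda>k. dist (z k) w) \<longlonglongrightarrow> 0"
  proof (rule tendsto_sandwich[OF _ _ tendsto_const LIMSEQ_inverse_real_of_nat])
    show "\<forall>\<^sub>F k in sequentially. dist (z k) w \<le> inverse (real (Suc k))"
      using mz(1) by (intro always_eventually) (auto simp: dist_commute less_imp_le)
  qed auto
  hence "z \<longlonglongrightarrow> w" by (simp add: tendsto_dist_iff[symmetric])
  hence zr: "(\<lambda>n. z (r n)) \<longlonglongrightarrow> w" using LIMSEQ_subseq_LIMSEQ[OF _ r] by (simp add: o_def)
  have ev: "\<forall>\<^sub>F n in sequentially. z (r n) \<in> cball w d"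
  proof -
    have "\<forall>\<^sub>F n in sequentially. dist (z (r n)) w < d" using zr d(1) by (rule tendstoD)
    thus ?thesis by eventually_elim (simp add: dist_commute)
  qed
  have lz: "(\<lambda>n. l (z (r n))) \<longlonglongrightarrow> l w"
    using d(1) by (intro continuous_on_tendsto_compose[OF l zr _ ev]) auto
  let ?u = "\<lambda>n. Fin ((poly p ^^ Suc (m (r n))) (z (r n)))"
  have "(\<lambda>n. dist (?u n) (l w)) \<longlonglongrightarrow> 0"
  proof (rule tendstoI)
    fix e :: real assume e: "e > 0"
    have "\<forall>\<^sub>F n in sequentially. \<forall>x\<in>cball w d. dist (Fin ((poly p ^^ Suc (m (r n))) x)) (l x) < e / 2"
      using e by (intro uniform_limitD[OF lim]) auto
    moreover have "\<forall>\<^sub>F n in sequentially. dist (l (z (r n))) (l w) < e / 2"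
      using e by (intro tendstoD[OF lz]) auto
    ultimately show "\<forall>\<^sub>F n in sequentially. dist (dist (?u n) (l w)) 0 < e"
      using ev
    proof eventually_elim
      case (elim n)
      have "dist (?u n) (l w) \<le> dist (?u n) (l (z (r n))) + dist (l (z (r n))) (l w)"
        by (rule dist_triangle)
      also have "\<dots> < e / 2 + e / 2" using elim by (intro add_strict_mono) blast+
      finally show ?case by simp
    qed
  qed
  hence "?u \<longlonglongrightarrow> l w" by (simp only: tendsto_dist_iff[symmetric])
  moreover have "closed (Fin ` A)" using A by (intro compact_imp_closed compact_Fin_image)
  moreover have "?u n \<in> Fin ` A" for n by (rule imageI, rule mz(2))
  ultimately have "l w \<in> Fin ` A"
    by (intro Lim_in_closed_set[of _ ?u sequentially]) auto
  hence "l w \<in> Fin ` O'" using O'(2) by auto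
  moreover have "(\<lambda>n. Fin ((poly p ^^ Suc (m (r n))) w)) \<longlonglongrightarrow> l w"
    using d(1) by (intro tendsto_uniform_limitI[OF lim]) auto
  ultimately have "\<forall>\<^sub>F n in sequentially. Fin ((poly p ^^ Suc (m (r n))) w) \<in> Fin ` O'"
    by (intro topological_tendstoD[OF _ open_Fin_image[OF O'(1)]])
  then obtain n where "Fin ((poly p ^^ Suc (m (r n))) w) \<in> Fin ` O'"
    unfolding eventually_sequentially by blast
  hence "(poly p ^^ Suc (m (r n))) w \<in> O'" by (simp only: inj_image_mem_iff[OF inj_Fin])
  thus False using mz(3) by blast
qed

subsection \<open>The nested preimages of \<open>J\<^sub>0\<close>\<close>

text \<open>In the plane: \<open>q\<close> is the generator \<open>h m\<close>, \<open>P\<close> consists of the remaining ones, and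
  \<open>B\<close> bounds the finite critical values of the semigroup.\<close>

locale nested_julia =
  fixes P :: "complex poly set" and q :: "complex poly" and J\<^sub>0 :: "complex set" and B :: real
    and G :: "(riemann_sphere \<Rightarrow> riemann_sphere) set" and JG :: "complex set"
  assumes G_def: "G = semigroup_generated (sphere_poly ` insert q P)"
    and JG_def: "JG = Fin -` julia_set G"
    and finP: "finite P" and neP: "P \<noteq> {}"
    and deg: "\<And>p. p \<in> insert q P \<Longrightarrow> degree p \<ge> 2"
    and crit: "\<And>f z. sphere_poly f \<in> G \<Longrightarrow> poly (pderiv f) z = 0 \<Longrightarrow> norm (poly f z) \<le> B"
    and disconn: "\<not> connected JG"
    and comp: "J\<^sub>0 \<in> components JG"
    and sub: "\<And>p. p \<in> P \<Longrightarrow> frontier (filled_julia p) \<subseteq> J\<^sub>0"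
    and meet: "\<And>p. p \<in> P \<Longrightarrow> poly p -` frontier (filled_julia q) \<inter> J\<^sub>0 \<noteq> {}"
begin

abbreviation "K \<equiv> filled_julia q"
definition "Jm = frontier K"
text \<open>The identity polynomial is adjoined so that \<open>Jm\<close>, \<open>K\<close> and
  \<open>A 0\<close> count among the preimages under \<open>S\<close>. It has no critical points, so
  the bound on critical values is unaffected.\<close>

definition "S = insert [:0, 1:] {f. sphere_poly f \<in> G}"
definition "A n = (poly q ^^ n) -` J\<^sub>0"

lemma degq: "degree q \<ge> 2" by (rule deg) simp

lemma degP: "p \<in> P \<Longrightarrow> degree p \<ge> 1"
  using deg[of p] by simp

lemma generator_in_S: assumes "p \<in> insert q P" shows "p \<in> S"
proof -
  have "sphere_poly p \<in> G"
    unfolding G_def by (rule semigroup_generated.gen[OF imageI[OF assms]])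
  thus ?thesis by (simp add: S_def)
qed

lemma pcompose_in_S:
  assumes "f \<in> S" "g \<in> S" shows "pcompose f g \<in> S"
proof (cases "f = [:0, 1:] \<or> g = [:0, 1:]")
  case True
  thus ?thesis using assms by (auto simp: pcompose_idR pcompose_pCons)
next
  case False
  hence "sphere_poly f \<in> G" "sphere_poly g \<in> G" using assms by (auto simp: S_def)
  hence "sphere_poly f \<circ> sphere_poly g \<in> G"
    unfolding G_def by (rule semigroup_generated.comp)
  thus ?thesis by (simp add: S_def sphere_poly_pcompose)
qed

lemma poly_iterate_in_S: "poly_iterate q n \<in> S"
proof (induction n)
  case (Suc n)
  have "poly_iterate q (Suc n) = pcompose q (poly_iterate q n)" by (simp add: poly_iterate_def)
  thus ?case using pcompose_in_S[OF generator_in_S Suc] by simp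
qed (simp add: poly_iterate_def S_def)

lemma degree_S: assumes "f \<in> S" shows "degree f \<ge> 1"
proof -
  have "\<exists>f. g = sphere_poly f \<and> degree f \<ge> 1" if "g \<in> G" for g
    using that unfolding G_def
  proof induction
    case (gen h)
    thus ?case using deg by (metis imageE one_le_numeral order_trans)
  next
    case (comp f g)
    then obtain a b where ab: "f = sphere_poly a" "degree a \<ge> 1" "g = sphere_poly b" "degree b \<ge> 1" by blast
    thus ?case by (intro exI[of _ "pcompose a b"]) (auto simp: sphere_poly_pcompose degree_pcompose)
  qed
  thus ?thesis using assms inj_sphere_poly unfolding S_def by fastforce
qed

lemma crit_S: "f \<in> S \<Longrightarrow> poly (pderiv f) z = 0 \<Longrightarrow> norm (poly f z) \<le> B"
  unfolding S_def using crit[of f z] by (auto simp: pderiv_pCons)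

lemma connected_vimage_K: "g \<in> S \<Longrightarrow> connected (poly g -` K)"
  by (rule connected_vimage_filled_julia[OF degq degree_S crit_S[OF pcompose_in_S[OF poly_iterate_in_S]]])

lemma vimage_Jm_eq: "g \<in> S \<Longrightarrow> poly g -` Jm = frontier (poly g -` K)"
  unfolding Jm_def by (rule poly_vimage_frontier[symmetric, OF degree_S])

lemma connected_vimage_Jm: "g \<in> S \<Longrightarrow> connected (poly g -` Jm)"
  unfolding vimage_Jm_eq
  by (rule connected_frontier_full[OF connected_vimage_K
        connected_Compl_vimage_filled_julia[OF degq degree_S]])

lemma outside_vimage_Jm: "g \<in> S \<Longrightarrow> outside (poly g -` Jm) = - (poly g -` K)"
  unfolding vimage_Jm_eq
  by (rule outside_frontier_full[OF compact_poly_vimage[OF degree_S compact_filled_julia[OF degq]]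
        connected_Compl_vimage_filled_julia[OF degq degree_S]])

lemma id_in_S: "[:0, 1:] \<in> S" by (simp add: S_def)

lemma connected_Jm: "connected Jm"
  using connected_vimage_Jm[OF id_in_S] by (simp add: vimage_def)

lemma outside_Jm: "outside Jm = - K"
  using outside_vimage_Jm[OF id_in_S] by (simp add: vimage_def)

lemma compact_Jm: "compact Jm"
  unfolding Jm_def by (rule compact_frontier[OF compact_filled_julia[OF degq]])

lemma Jm_nonempty: "Jm \<noteq> {}"
  using frontier_filled_julia_two_points[OF degq] by (auto simp: Jm_def)

lemma vimage_Jm_iterate: "(poly q ^^ n) -` Jm = Jm"
proof -
  have "poly (poly_iterate q n) -` Jm = frontier (poly (poly_iterate q n) -` K)"
    by (rule vimage_Jm_eq[OF poly_iterate_in_S])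
  thus ?thesis by (simp add: poly_poly_iterate funpow_vimage_filled_julia Jm_def)
qed

text \<open>A critical value lies in every \<open>g\<^sup>-\<^sup>1(K)\<close>, so all the continua below surround it.\<close>

lemma common_point: "\<exists>z. \<forall>g\<in>S. z \<in> poly g -` K"
proof -
  obtain p where p: "p \<in> P" using neP by blast
  have "degree (pderiv p) \<ge> 1" using deg[of p] p by (simp add: degree_pderiv)
  then obtain c where c: "poly (pderiv p) c = 0"
    using surjD[OF surj_poly, of "pderiv p" 0] by metis
  have "poly p c \<in> poly g -` K" if g: "g \<in> S" for g
  proof -
    have "norm ((poly q ^^ n) (poly g (poly p c))) \<le> B" for n
    proof -
      \<comment> \<open>By the chain rule a critical point of \<open>p\<close> stays critical when
        further maps are applied after \<open>p\<close>. So the \<open>q\<close>-orbit of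
        \<open>poly g (poly p c)\<close> consists of critical values of elements of
        \<open>S\<close>.\<close>
      let ?f = "pcompose (poly_iterate q n) (pcompose g p)"
      have "?f \<in> S" by (intro pcompose_in_S poly_iterate_in_S g generator_in_S) (use p in auto)
      moreover have "poly (pderiv ?f) c = 0" using c by (simp add: pderiv_pcompose)
      ultimately have "norm (poly ?f c) \<le> B" by (rule crit_S)
      thus ?thesis by (simp add: poly_pcompose poly_poly_iterate)
    qed
    thus ?thesis by (auto simp: filled_julia_def bounded_iff)
  qed
  thus ?thesis by blast
qed

section \<open>The component \<open>J\<^sub>0\<close> and its position relative to
  \<open>Jm\<close>\<close>

lemma fin_generators: "finite (insert q P)" using finP by simp

lemma julia_G: "julia_set G = Fin ` JG"
  using julia_set_subset_range_Fin(1)[OF fin_generators deg] unfolding G_def JG_def by auto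

lemma compact_JG: "compact JG"
  unfolding JG_def G_def by (rule julia_set_subset_range_Fin(2)[OF fin_generators deg])

lemma vimage_JG: "p \<in> insert q P \<Longrightarrow> poly p -` JG \<subseteq> JG"
  using julia_set_vimage[of "sphere_poly p" "insert q P" p] deg[of p]
  unfolding G_def JG_def by (auto intro: semigroup_generated.gen)

lemma Jm_subset_JG: "Jm \<subseteq> JG"
proof -
  have "julia (sphere_poly q) \<subseteq> julia_set G"
    unfolding G_def by (intro julia_set_mono semigroup_generated_mono) auto
  thus ?thesis unfolding julia_sphere_poly[OF degq] JG_def Jm_def by auto
qed

lemma connected_subset_J0: "connected C \<Longrightarrow> C \<subseteq> JG \<Longrightarrow> C \<inter> J\<^sub>0 \<noteq> {} \<Longrightarrow> C \<subseteq> J\<^sub>0"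
  by (rule components_maximal[OF comp]) auto

lemma J0_subset_JG: "J\<^sub>0 \<subseteq> JG" by (rule in_components_subset[OF comp])

lemma connected_J0: "connected J\<^sub>0" by (rule in_components_connected[OF comp])

lemma compact_J0: "compact J\<^sub>0"
  using compact_JG closedin_compact closedin_component[OF comp] by blast

lemma J0_two_points: "\<exists>a\<in>J\<^sub>0. \<exists>b\<in>J\<^sub>0. a \<noteq> b"
proof -
  obtain p where p: "p \<in> P" using neP by blast
  thus ?thesis using frontier_filled_julia_two_points[of p] deg[of p] sub[OF p] by blast
qed

text \<open>By confluence every component of the preimage maps onto \<open>J\<^sub>0\<close>, so it
  reaches the Julia set of \<open>f\<close>. That set is completely invariant and lies in
  \<open>J\<^sub>0\<close>, so the component meets \<open>J\<^sub>0\<close>.\<close>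

lemma vimage_J0_subset:
  assumes f: "f \<in> insert q P" and fr: "frontier (filled_julia f) \<subseteq> J\<^sub>0"
  shows "poly f -` J\<^sub>0 \<subseteq> J\<^sub>0"
proof
  fix x assume x: "x \<in> poly f -` J\<^sub>0"
  have d: "degree f \<ge> 1" "degree f \<ge> 2" using deg[OF f] by auto
  obtain C where C: "C \<in> components (poly f -` J\<^sub>0)" "x \<in> C"
    using x by (metis Union_components UnionE)
  have "poly f ` C = J\<^sub>0" by (rule poly_image_component[OF d(1) compact_J0 connected_J0 C(1)])
  moreover obtain y where y: "y \<in> frontier (filled_julia f)"
    using frontier_filled_julia_two_points[OF d(2)] by blast
  ultimately obtain c where c: "c \<in> C" "poly f c = y" using fr by blast
  hence "c \<in> frontier (filled_julia f)"
    using y poly_vimage_frontier[OF d(1), of "filled_julia f"] by (auto simp: vimage_filled_julia)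
  hence "C \<inter> J\<^sub>0 \<noteq> {}" using c fr by auto
  moreover have "C \<subseteq> JG"
    using in_components_subset[OF C(1)] vimage_JG[OF f] J0_subset_JG by blast
  ultimately have "C \<subseteq> J\<^sub>0" using connected_subset_J0 in_components_connected[OF C(1)] by blast
  thus "x \<in> J\<^sub>0" using C(2) by auto
qed

lemma P_vimage_J0: "p \<in> P \<Longrightarrow> poly p -` J\<^sub>0 \<subseteq> J\<^sub>0"
  using vimage_J0_subset sub by simp

text \<open>Otherwise \<open>J\<^sub>0\<close> absorbs \<open>Jm\<close> and becomes backward
  invariant under all generators. It would then be the whole Julia set, which is
  disconnected.\<close>

lemma J0_disjoint_Jm: "J\<^sub>0 \<inter> Jm = {}"
proof (rule ccontr)
  assume "J\<^sub>0 \<inter> Jm \<noteq> {}"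
  hence "Jm \<subseteq> J\<^sub>0" using connected_subset_J0[OF connected_Jm Jm_subset_JG] by blast
  hence "poly p -` J\<^sub>0 \<subseteq> J\<^sub>0" if "p \<in> insert q P" for p
    using that vimage_J0_subset sub by (auto simp: Jm_def)
  hence "julia_set G \<subseteq> Fin ` J\<^sub>0"
    unfolding G_def
    using finP deg compact_imp_closed[OF compact_J0] J0_two_points
    by (intro julia_set_subset_backward_invariant) auto
  hence "JG = J\<^sub>0" using J0_subset_JG julia_G by auto
  thus False using disconn connected_J0 by simp
qed

lemma P_vimage_Jm: assumes "p \<in> P" shows "poly p -` Jm \<subseteq> J\<^sub>0"
proof (rule connected_subset_J0)
  show "connected (poly p -` Jm)" using assms by (intro connected_vimage_Jm generator_in_S) simp
  show "poly p -` Jm \<subseteq> JG" using vimage_JG[of p] assms Jm_subset_JG by auto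
  show "poly p -` Jm \<inter> J\<^sub>0 \<noteq> {}" using meet[OF assms] by (simp add: Jm_def)
qed

text \<open>The preimage contains the connected set of points sent by \<open>p\<close> after
  \<open>f\<close> into \<open>Jm\<close>. That set includes the whole \<open>f\<close>-fibre over a
  point of \<open>J\<^sub>0\<close> with \<open>p\<close>-image in \<open>Jm\<close>, so every
  component of the preimage meets it. It also confines the exterior, which puts the common point on
  the surrounded side.\<close>

lemma vimage_J0_continuum:
  assumes f: "f \<in> S"
  shows "compact (poly f -` J\<^sub>0)" "connected (poly f -` J\<^sub>0)"
    "outside (poly f -` J\<^sub>0) \<inter> (\<Inter>g\<in>S. poly g -` K) = {}"
proof -
  obtain p where p: "p \<in> P" using neP by blast
  have gS: "pcompose p f \<in> S" using p by (intro pcompose_in_S generator_in_S f) simp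
  have sub: "poly (pcompose p f) -` Jm \<subseteq> poly f -` J\<^sub>0"
    using P_vimage_Jm[OF p] by (auto simp: poly_pcompose)
  show "compact (poly f -` J\<^sub>0)" by (rule compact_poly_vimage[OF degree_S[OF f] compact_J0])
  show "connected (poly f -` J\<^sub>0)"
  proof (rule connected_if_components_meet[OF connected_vimage_Jm[OF gS] sub])
    fix C assume "C \<in> components (poly f -` J\<^sub>0)"
    hence "poly f ` C = J\<^sub>0" by (rule poly_image_component[OF degree_S[OF f] compact_J0 connected_J0])
    moreover obtain x where x: "poly p x \<in> Jm" "x \<in> J\<^sub>0"
      using meet[OF p] by (auto simp: Jm_def)
    ultimately obtain c where "c \<in> C" "poly f c = x" by blast
    thus "C \<inter> poly (pcompose p f) -` Jm \<noteq> {}" using x by (auto simp: poly_pcompose)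
  qed
  have "outside (poly f -` J\<^sub>0) \<subseteq> - (poly (pcompose p f) -` K)"
    using outside_mono[OF sub] outside_vimage_Jm[OF gS] by simp
  thus "outside (poly f -` J\<^sub>0) \<inter> (\<Inter>g\<in>S. poly g -` K) = {}" using gS by blast
qed

section \<open>Disjointness and nesting of the sets \<open>A n\<close>\<close>

lemma A_poly: "A n = poly (poly_iterate q n) -` J\<^sub>0"
  by (simp add: A_def poly_poly_iterate)

lemma A_0: "A 0 = J\<^sub>0" by (simp add: A_def)

lemma A_add: "A (n + k) = (poly q ^^ k) -` A n"
  by (auto simp: A_def funpow_add)

lemma A_Suc: "A (Suc n) = poly q -` A n"
  using A_add[of n 1] by simp

lemma compact_A: "compact (A n)" and connected_A: "connected (A n)"
  unfolding A_poly by (rule vimage_J0_continuum[OF poly_iterate_in_S])+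

lemma A_nonempty: "A n \<noteq> {}"
proof -
  obtain x where "x \<in> J\<^sub>0" using J0_two_points by blast
  moreover obtain y where "x = poly (poly_iterate q n) y"
    using surjD[OF surj_poly[OF degree_S[OF poly_iterate_in_S]]] by blast
  ultimately show ?thesis by (auto simp: A_poly)
qed

lemma A_subset_JG: "A n \<subseteq> JG"
proof (induction n)
  case (Suc n)
  thus ?case using vimage_JG[of q] by (auto simp: A_Suc)
qed (simp add: A_0 J0_subset_JG)

lemma A_disjoint_Jm: "A n \<inter> Jm = {}"
proof -
  have "A n \<inter> Jm = (poly q ^^ n) -` (J\<^sub>0 \<inter> Jm)"
    using vimage_Jm_iterate[of n] by (auto simp: A_def)
  thus ?thesis by (simp add: J0_disjoint_Jm)
qed

lemma Jm_subset_backward_invariant: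
  assumes "closed X" "\<exists>a\<in>X. \<exists>b\<in>X. a \<noteq> b" "poly q -` X \<subseteq> X"
  shows "Jm \<subseteq> X"
proof -
  have "julia_set (semigroup_generated (sphere_poly ` {q})) \<subseteq> Fin ` X"
    by (rule julia_set_subset_backward_invariant) (use assms degq in auto)
  thus ?thesis using julia_sphere_poly[OF degq] by (auto simp: Jm_def)
qed

text \<open>If \<open>A n\<close> fell back into \<open>J\<^sub>0\<close>, the finite union of
  \<open>A 0\<close> up to \<open>A (n - 1)\<close> would be closed and backward invariant under
  \<open>q\<close>. It would contain \<open>Jm\<close>, from which each \<open>A i\<close> is
  disjoint.\<close>

lemma A_disjoint_J0: assumes "n > 0" shows "A n \<inter> J\<^sub>0 = {}"
proof (rule ccontr)
  assume "A n \<inter> J\<^sub>0 \<noteq> {}"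
  hence An: "A n \<subseteq> J\<^sub>0" by (rule connected_subset_J0[OF connected_A A_subset_JG])
  define X where "X = (\<Union>i<n. A i)"
  have J0X: "J\<^sub>0 \<subseteq> X" unfolding X_def using assms A_0 by blast
  have "Jm \<subseteq> X"
  proof (rule Jm_subset_backward_invariant)
    show "closed X" unfolding X_def
      by (intro closed_UN) (auto intro: compact_imp_closed compact_A)
    show "\<exists>a\<in>X. \<exists>b\<in>X. a \<noteq> b" using J0_two_points J0X by blast
    have "A (Suc i) \<subseteq> X" if "i < n" for i
    proof (cases "Suc i = n")
      case True
      thus ?thesis using An J0X by simp
    next
      case False
      hence "Suc i \<in> {..<n}" using that by simp
      thus ?thesis unfolding X_def by blast
    qed
    thus "poly q -` X \<subseteq> X" unfolding X_def A_Suc by blast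
  qed
  thus False using Jm_nonempty A_disjoint_Jm unfolding X_def by blast
qed

lemma A_disjoint: assumes "n \<noteq> k" shows "A n \<inter> A k = {}"
proof -
  have "A n \<inter> A k = {}" if "k < n" for n k
  proof -
    have "A n \<inter> A k = (poly q ^^ k) -` (A (n - k) \<inter> J\<^sub>0)"
      using that A_add[of "n - k" k] A_add[of 0 k] by (simp add: A_0)
    thus ?thesis using A_disjoint_J0[of "n - k"] that by simp
  qed
  thus ?thesis using assms by (metis Int_commute nat_neq_iff)
qed

lemma vimage_inside_iterate:
  "compact X \<Longrightarrow> inside ((poly q ^^ n) -` X) = (poly q ^^ n) -` inside X"
  using poly_vimage_inside[OF degree_S[OF poly_iterate_in_S[of n]]] by (simp add: poly_poly_iterate)

lemma vimage_outside_iterate: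
  "compact X \<Longrightarrow> outside ((poly q ^^ n) -` X) = (poly q ^^ n) -` outside X"
  using poly_vimage_outside[OF degree_S[OF poly_iterate_in_S[of n]]] by (simp add: poly_poly_iterate)

lemma nested_A_J0: "n > 0 \<Longrightarrow> A n \<subseteq> inside J\<^sub>0 \<or> J\<^sub>0 \<subseteq> inside (A n)"
proof -
  assume n: "n > 0"
  obtain z where z: "z \<in> (\<Inter>g\<in>S. poly g -` K)" using common_point by blast
  have "z \<notin> outside (A n)" "z \<notin> outside (A 0)"
    using vimage_J0_continuum(3)[OF poly_iterate_in_S] z unfolding A_poly by blast+
  thus ?thesis
    by (intro compact_connected_nested compact_A connected_A compact_J0 connected_J0 A_disjoint_J0 n)
       (auto simp: A_0)
qed

lemma nested_Jm_J0: "J\<^sub>0 \<subseteq> inside Jm \<or> Jm \<subseteq> inside J\<^sub>0"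
proof -
  obtain z where z: "z \<in> (\<Inter>g\<in>S. poly g -` K)" using common_point by blast
  have "z \<notin> outside (A 0)"
    using vimage_J0_continuum(3)[OF poly_iterate_in_S] z unfolding A_poly by blast
  moreover have "z \<in> poly [:0, 1:] -` K" using z id_in_S by blast
  hence "z \<notin> outside Jm" by (simp add: outside_Jm)
  ultimately show ?thesis
    by (intro compact_connected_nested compact_Jm connected_Jm compact_J0 connected_J0 J0_disjoint_Jm)
       (auto simp: A_0)
qed

end

lemma inside_subset_inside:
  fixes X Y :: "complex set"
  assumes "compact X" "compact Y" "connected Y" "X \<subseteq> inside Y"
  shows "inside X \<subseteq> inside Y"
  using assms by (intro inside_inside_compact_connected compact_imp_closed)

lemma clopen_in_components:
  assumes "C \<noteq> {}" "connected C" "C \<subseteq> S" "closed C" "closed (S - C)"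
  shows "C \<in> components S"
proof -
  obtain x where x: "x \<in> C" using assms(1) by blast
  let ?D = "connected_component_set S x"
  have "C \<subseteq> ?D" using assms x by (intro connected_component_maximal) auto
  moreover have "?D \<subseteq> C"
  proof (rule ccontr)
    assume "\<not> ?D \<subseteq> C"
    moreover have "?D \<subseteq> S" by (rule connected_component_subset)
    ultimately have "(S - C) \<inter> ?D \<noteq> {}" "?D \<subseteq> C \<union> (S - C)" by auto
    moreover have "C \<inter> ?D \<noteq> {}" using x \<open>C \<subseteq> ?D\<close> by auto
    moreover have "C \<inter> (S - C) \<inter> ?D = {}" by auto
    ultimately show False
      using connected_connected_component[of S x] assms(4,5) unfolding connected_closed by blast
  qed
  ultimately have "C = ?D" by auto
  thus ?thesis using x assms(3) by (auto simp: components_def)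
qed

context nested_julia
begin

text \<open>In the wrong order \<open>q\<close> maps the exterior of \<open>J\<^sub>0\<close> into
  itself, so the filled \<open>J\<^sub>0\<close> is backward invariant. It then contains
  \<open>Jm\<close>, and the two sets would surround each other.\<close>

lemma J0_inside_A1: assumes "J\<^sub>0 \<subseteq> inside Jm" shows "J\<^sub>0 \<subseteq> inside (A 1)"
proof (rule ccontr)
  assume "\<not> J\<^sub>0 \<subseteq> inside (A 1)"
  hence "A 1 \<subseteq> inside J\<^sub>0" using nested_A_J0[of 1] by simp
  hence "outside J\<^sub>0 \<subseteq> outside (A 1)" by (rule outside_antimono_inside[OF compact_J0])
  also have "outside (A 1) = poly q -` outside J\<^sub>0"
    using vimage_outside_iterate[OF compact_J0, of 1] by (simp add: A_def)
  finally have inv: "outside J\<^sub>0 \<subseteq> poly q -` outside J\<^sub>0" .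
  have "Jm \<subseteq> - outside J\<^sub>0"
  proof (rule Jm_subset_backward_invariant)
    show "closed (- outside J\<^sub>0)"
      by (intro closed_Compl open_outside compact_imp_closed compact_J0)
    show "\<exists>a\<in>- outside J\<^sub>0. \<exists>b\<in>- outside J\<^sub>0. a \<noteq> b"
      using J0_two_points outside_no_overlap[of "J\<^sub>0"] by blast
    show "poly q -` (- outside J\<^sub>0) \<subseteq> - outside J\<^sub>0" using inv by auto
  qed
  hence "Jm \<subseteq> inside J\<^sub>0" using J0_disjoint_Jm inside_Un_outside[of "J\<^sub>0"] by blast
  thus False using inside_asym[OF compact_Jm compact_J0 Jm_nonempty] assms by blast
qed

text \<open>In the wrong order the filled \<open>J\<^sub>0\<close> is forward invariant. As it is
  bounded, \<open>J\<^sub>0\<close> lies in \<open>K\<close> and hence inside \<open>Jm\<close>, so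
  again the two sets would surround each other.\<close>

lemma A1_inside_J0: assumes "Jm \<subseteq> inside J\<^sub>0" shows "A 1 \<subseteq> inside J\<^sub>0"
proof (rule ccontr)
  assume "\<not> A 1 \<subseteq> inside J\<^sub>0"
  hence "J\<^sub>0 \<subseteq> inside (A 1)" using nested_A_J0[of 1] by simp
  hence "outside (A 1) \<subseteq> outside J\<^sub>0" by (rule outside_antimono_inside[OF compact_A])
  moreover have "outside (A 1) = poly q -` outside J\<^sub>0"
    using vimage_outside_iterate[OF compact_J0, of 1] by (simp add: A_def)
  ultimately have step: "poly q x \<notin> outside J\<^sub>0" if "x \<notin> outside J\<^sub>0" for x using that by auto
  have "x \<in> K" if x: "x \<in> J\<^sub>0" for x
  proof -
    have "x \<notin> outside J\<^sub>0" using outside_no_overlap[of "J\<^sub>0"] x by blast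
    hence "(poly q ^^ n) x \<in> - outside J\<^sub>0" for n
      by (induction n) (simp_all add: step)
    hence "range (\<lambda>n. (poly q ^^ n) x) \<subseteq> - outside J\<^sub>0" by (rule image_subsetI)
    hence "bounded (range (\<lambda>n. (poly q ^^ n) x))"
      by (rule bounded_subset[OF cobounded_outside[OF compact_imp_bounded[OF compact_J0]]])
    thus ?thesis by (simp add: filled_julia_def)
  qed
  hence "J\<^sub>0 \<subseteq> inside Jm" using outside_Jm J0_disjoint_Jm inside_Un_outside[of Jm] by blast
  thus False using inside_asym[OF compact_Jm compact_J0 Jm_nonempty assms] by blast
qed

text \<open>The case of \<open>J\<^sub>0\<close> and \<open>A 1\<close> is pulled back by iterates
  of \<open>q\<close>, since insides commute with preimages.\<close>

lemma A_nested_up: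
  assumes "J\<^sub>0 \<subseteq> inside Jm" "n < k" shows "A n \<subseteq> inside (A k)"
  using assms(2)
proof (induction k)
  case (Suc k)
  have step: "A k \<subseteq> inside (A (Suc k))"
  proof -
    have "A k = (poly q ^^ k) -` J\<^sub>0" by (simp add: A_def)
    also have "\<dots> \<subseteq> (poly q ^^ k) -` inside (A 1)" using J0_inside_A1[OF assms(1)] by blast
    also have "\<dots> = inside (A (Suc k))"
      using vimage_inside_iterate[OF compact_A[of 1], of k] A_add[of 1 k] by simp
    finally show ?thesis .
  qed
  show ?case
  proof (cases "n = k")
    case False
    hence "A n \<subseteq> inside (A k)" using Suc by simp
    also have "\<dots> \<subseteq> inside (A (Suc k))"
      by (rule inside_subset_inside[OF compact_A compact_A connected_A step])
    finally show ?thesis .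
  qed (use step in simp)
qed simp

lemma A_nested_down:
  assumes "Jm \<subseteq> inside J\<^sub>0" "n < k" shows "A k \<subseteq> inside (A n)"
  using assms(2)
proof (induction k)
  case (Suc k)
  have step: "A (Suc k) \<subseteq> inside (A k)"
  proof -
    have "A (Suc k) = (poly q ^^ k) -` A 1" using A_add[of 1 k] by simp
    also have "\<dots> \<subseteq> (poly q ^^ k) -` inside J\<^sub>0" using A1_inside_J0[OF assms(1)] by blast
    also have "\<dots> = inside (A k)"
      using vimage_inside_iterate[OF compact_J0, of k] by (simp add: A_def)
    finally show ?thesis .
  qed
  show ?case
  proof (cases "n = k")
    case False
    note step
    also have "inside (A k) \<subseteq> inside (A n)"
      using False Suc by (intro inside_subset_inside compact_A connected_A) auto
    finally show ?thesis .
  qed (use step in simp)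
qed simp

lemma A_inside_Jm: assumes "J\<^sub>0 \<subseteq> inside Jm" shows "A n \<subseteq> inside Jm"
proof -
  have "A n \<subseteq> (poly q ^^ n) -` inside Jm" using assms by (auto simp: A_def)
  thus ?thesis using vimage_inside_iterate[OF compact_Jm, of n] by (simp add: vimage_Jm_iterate)
qed

lemma Jm_inside_A: assumes "Jm \<subseteq> inside J\<^sub>0" shows "Jm \<subseteq> inside (A n)"
proof -
  have "(poly q ^^ n) -` Jm \<subseteq> (poly q ^^ n) -` inside J\<^sub>0" using assms by auto
  thus ?thesis using vimage_inside_iterate[OF compact_J0, of n] by (simp add: vimage_Jm_iterate A_def)
qed

text \<open>An open set around \<open>J\<^sub>0\<close> on the far side of \<open>A 1\<close> from \<open>Jm\<close>.\<close>

lemma separating_neighbourhood: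
  "\<exists>V. open V \<and> J\<^sub>0 \<subseteq> V \<and> (\<forall>n k. k > Suc n \<longrightarrow> (poly q ^^ n) -` V \<inter> A k = {})"
  using nested_Jm_J0
proof
  assume *: "J\<^sub>0 \<subseteq> inside Jm"
  have "(poly q ^^ n) -` inside (A 1) \<inter> A k = {}" if "k > Suc n" for n k
  proof -
    have "(poly q ^^ n) -` inside (A 1) = inside (A (Suc n))"
      using vimage_inside_iterate[OF compact_A[of 1], of n] A_add[of 1 n] by simp
    also have "\<dots> \<subseteq> inside (A k)"
      by (rule inside_subset_inside[OF compact_A compact_A connected_A A_nested_up[OF * that]])
    finally show ?thesis using inside_no_overlap[of "A k"] by blast
  qed
  moreover have "open (inside (A 1))" by (intro open_inside compact_imp_closed compact_A)
  ultimately show ?thesis using J0_inside_A1[OF *] by (intro exI[of _ "inside (A 1)"]) auto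
next
  assume *: "Jm \<subseteq> inside J\<^sub>0"
  have "(poly q ^^ n) -` outside (A 1) \<inter> A k = {}" if "k > Suc n" for n k
  proof -
    have "(poly q ^^ n) -` outside (A 1) = outside (A (Suc n))"
      using vimage_outside_iterate[OF compact_A[of 1], of n] A_add[of 1 n] by simp
    thus ?thesis using A_nested_down[OF * that] inside_Int_outside[of "A (Suc n)"] by blast
  qed
  moreover have "J\<^sub>0 \<subseteq> outside (A 1)"
  proof -
    have "\<not> J\<^sub>0 \<subseteq> inside (A 1)"
      using inside_asym[OF compact_A compact_J0 A_nonempty A1_inside_J0[OF *]] by blast
    moreover have "J\<^sub>0 \<inter> A 1 = {}" using A_disjoint_J0[of 1] by auto
    ultimately show ?thesis using connected_subset_inside_or_outside[OF connected_J0] by blast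
  qed
  moreover have "open (outside (A 1))" by (intro open_outside compact_imp_closed compact_A)
  ultimately show ?thesis by (intro exI[of _ "outside (A 1)"]) auto
qed

text \<open>If the orbit of \<open>w\<close> enters the separating set \<open>V\<close> at some time
  \<open>n\<close> beyond \<open>N\<close>, the preimage of \<open>V\<close> under that iterate is a
  neighbourhood of \<open>w\<close> missing all \<open>A k\<close> with \<open>k > Suc n\<close>. If
  it never does so, equicontinuity keeps nearby orbits out of \<open>J\<^sub>0\<close> from time
  \<open>N\<close> on.\<close>

lemma A_accumulate_at_Jm:
  assumes "w \<notin> Jm"
  shows "\<exists>e>0. \<exists>N. \<forall>n\<ge>N. ball w e \<inter> A n = {}"
proof -
  obtain V where V: "open V" "J\<^sub>0 \<subseteq> V" "\<And>n k. k > Suc n \<Longrightarrow> (poly q ^^ n) -` V \<inter> A k = {}"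
    using separating_neighbourhood by auto
  have "Fin w \<notin> julia (sphere_poly q)"
    using assms julia_sphere_poly[OF degq] by (auto simp: Jm_def)
  from fatou_iterates_near[OF this compact_J0 V(1,2)]
  obtain e N where e: "e > 0"
    "\<forall>n\<ge>N. \<forall>z\<in>ball w e. (poly q ^^ n) z \<in> J\<^sub>0 \<longrightarrow> (poly q ^^ n) w \<in> V"
    by blast
  show ?thesis
  proof (cases "\<exists>n\<ge>N. (poly q ^^ n) w \<in> V")
    case True
    then obtain n where n: "(poly q ^^ n) w \<in> V" by blast
    have "open (poly (poly_iterate q n) -` V)"
      by (intro open_vimage V(1) continuous_intros)
    moreover have "w \<in> poly (poly_iterate q n) -` V" using n by (simp add: poly_poly_iterate)
    ultimately obtain d where d: "d > 0" "ball w d \<subseteq> (poly q ^^ n) -` V"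
      unfolding open_contains_ball poly_poly_iterate by blast
    have "ball w d \<inter> A k = {}" if "k \<ge> Suc (Suc n)" for k
      using d(2) V(3)[of n k] that by (auto simp del: mem_ball)
    thus ?thesis using d(1) by blast
  next
    case False
    hence "ball w e \<inter> A n = {}" if "n \<ge> N" for n
      using e(2) that unfolding A_def by blast
    thus ?thesis using e(1) by blast
  qed
qed

text \<open>Away from \<open>Jm\<close> the family is locally finite. The index set is arbitrary so
  that the statement serves both the full union and the union with one member removed.\<close>

lemma closed_Jm_Union_A: "closed (Jm \<union> (\<Union>n\<in>M. A n))"
proof -
  let ?X = "Jm \<union> (\<Union>n\<in>M. A n)"
  have "\<exists>e>0. ball w e \<subseteq> - ?X" if w: "w \<notin> ?X" for w
  proof -
    obtain e N where e: "e > 0" "\<And>n. n \<ge> N \<Longrightarrow> ball w e \<inter> A n = {}"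
      using A_accumulate_at_Jm[of w] w by auto
    define F where "F = Jm \<union> (\<Union>n\<in>M \<inter> {..<N}. A n)"
    have "closed F" unfolding F_def
      by (intro closed_Un closed_UN compact_imp_closed compact_Jm compact_A ballI) auto
    moreover have "w \<in> - F" using w by (auto simp: F_def)
    ultimately obtain d where d: "d > 0" "ball w d \<subseteq> - F"
      by (meson open_Compl open_contains_ball)
    have "ball w (min d e) \<subseteq> - ?X"
    proof
      fix x assume "x \<in> ball w (min d e)"
      hence x: "x \<in> ball w d" "x \<in> ball w e" by auto
      have "x \<notin> A n" if "n \<in> M" for n
      proof (cases "n < N")
        case True
        hence "A n \<subseteq> F" using that by (auto simp: F_def)
        thus ?thesis using x(1) d(2) by blast
      next
        case False
        thus ?thesis using e(2)[of n] x(2) by auto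
      qed
      moreover have "x \<notin> Jm" using x(1) d(2) by (auto simp: F_def)
      ultimately show "x \<in> - ?X" by blast
    qed
    thus ?thesis using d(1) e(1) by (intro exI[of _ "min d e"]) auto
  qed
  hence "open (- ?X)" unfolding open_contains_ball by blast
  thus ?thesis by (simp add: open_closed)
qed

text \<open>If \<open>p\<^sup>-\<^sup>1(A n)\<close> missed \<open>J\<^sub>0\<close>, it would surround the part \<open>p\<^sup>-\<^sup>1(L)\<close> of \<open>J\<^sub>0\<close> and be surrounded by
  the part \<open>p\<^sup>-\<^sup>1(U)\<close>.\<close>

lemma sandwiched_vimage_subset_J0:
  assumes p: "p \<in> P" and LU: "L \<in> {J\<^sub>0, Jm}" "U \<in> {J\<^sub>0, Jm}"
    and nest: "L \<subseteq> inside (A n)" "A n \<subseteq> inside U"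
  shows "poly p -` A n \<subseteq> J\<^sub>0"
proof (rule ccontr)
  assume not: "\<not> poly p -` A n \<subseteq> J\<^sub>0"
  let ?B = "poly p -` A n"
  have fS: "pcompose (poly_iterate q n) p \<in> S"
    using p by (intro pcompose_in_S poly_iterate_in_S generator_in_S) simp
  have B: "?B = poly (pcompose (poly_iterate q n) p) -` J\<^sub>0"
    by (auto simp: A_poly poly_pcompose)
  have cB: "compact ?B" "connected ?B"
    unfolding B by (rule vimage_J0_continuum[OF fS])+
  have "?B \<subseteq> JG" using vimage_JG[of p] p A_subset_JG[of n] by auto
  hence disj: "?B \<inter> J\<^sub>0 = {}" using connected_subset_J0[OF cB(2)] not by blast
  have LU': "poly p -` L \<subseteq> J\<^sub>0" "poly p -` U \<subseteq> J\<^sub>0"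
    using LU P_vimage_J0[OF p] P_vimage_Jm[OF p] by auto
  have "L \<noteq> {}" using LU(1) Jm_nonempty J0_two_points by auto
  then obtain x where x: "poly p x \<in> L" using surjD[OF surj_poly[OF degP[OF p]]] by (metis ex_in_conv)
  have "x \<in> inside ?B"
    using x nest(1) poly_vimage_inside[OF degP[OF p] compact_A[of n]] by auto
  moreover have "x \<in> J\<^sub>0" using x LU'(1) by auto
  ultimately have "J\<^sub>0 \<subseteq> inside ?B"
    using connected_subset_inside[OF connected_J0, of ?B] disj by blast
  moreover have "compact U" using LU(2) compact_J0 compact_Jm by auto
  hence "?B \<subseteq> inside (poly p -` U)"
    using nest(2) poly_vimage_inside[OF degP[OF p], of U] by auto
  \<comment> \<open>Passing from the preimage of \<open>U\<close> to the larger
    \<open>J\<^sub>0\<close> may lose points of the inside, but only to \<open>J\<^sub>0\<close>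
    itself, which is disjoint from \<open>?B\<close>.\<close>
  hence "?B \<subseteq> inside J\<^sub>0" using inside_mono[OF LU'(2)] disj by blast
  moreover have "J\<^sub>0 \<noteq> {}" using J0_two_points by auto
  ultimately show False using inside_asym[OF compact_J0 cB(1)] by blast
qed

lemma P_vimage_A: assumes p: "p \<in> P" shows "poly p -` A n \<subseteq> J\<^sub>0"
proof (cases "n = 0")
  case True
  thus ?thesis using P_vimage_J0[OF p] by (simp add: A_0)
next
  case False
  from nested_Jm_J0 show ?thesis
  proof
    assume *: "J\<^sub>0 \<subseteq> inside Jm"
    show ?thesis
      using A_nested_up[OF *, of 0 n] False A_inside_Jm[OF *, of n]
      by (intro sandwiched_vimage_subset_J0[OF p, of "J\<^sub>0" Jm]) (auto simp: A_0)
  next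
    assume *: "Jm \<subseteq> inside J\<^sub>0"
    show ?thesis
      using A_nested_down[OF *, of 0 n] False Jm_inside_A[OF *, of n]
      by (intro sandwiched_vimage_subset_J0[OF p, of Jm "J\<^sub>0"]) (auto simp: A_0)
  qed
qed

section \<open>The Julia set of the semigroup and its components\<close>

lemma JG_eq: "JG = Jm \<union> (\<Union>n. A n)"
proof
  show "Jm \<union> (\<Union>n. A n) \<subseteq> JG" using Jm_subset_JG A_subset_JG by auto
  have "julia_set G \<subseteq> Fin ` (Jm \<union> (\<Union>n. A n))"
    unfolding G_def
  proof (rule julia_set_subset_backward_invariant[OF fin_generators deg closed_Jm_Union_A])
    have A0: "A 0 \<subseteq> Jm \<union> (\<Union>n. A n)" by auto
    hence "J\<^sub>0 \<subseteq> Jm \<union> (\<Union>n. A n)" by (simp only: A_0)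
    thus "\<exists>a\<in>Jm \<union> (\<Union>n. A n). \<exists>b\<in>Jm \<union> (\<Union>n. A n). a \<noteq> b"
      using J0_two_points by (meson subsetD)
    show "poly p -` (Jm \<union> (\<Union>n. A n)) \<subseteq> Jm \<union> (\<Union>n. A n)" if "p \<in> insert q P" for p
    proof (cases "p \<in> P")
      case True
      hence "poly p -` (Jm \<union> (\<Union>n. A n)) \<subseteq> A 0"
        using P_vimage_Jm[OF True] P_vimage_A[OF True] unfolding A_0 by blast
      thus ?thesis using A0 by (rule subset_trans)
    next
      case False
      hence "p = q" using that by simp
      moreover have "poly q -` Jm = Jm" using vimage_Jm_iterate[of 1] by simp
      moreover have "poly q -` (\<Union>n. A n) = (\<Union>n. A (Suc n))" by (auto simp: A_Suc)
      ultimately show ?thesis by auto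
    qed
  qed
  thus "JG \<subseteq> Jm \<union> (\<Union>n. A n)" unfolding julia_G by (simp add: inj_image_subset_iff[OF inj_Fin])
qed

text \<open>Relative openness of \<open>A n\<close> in the Julia set: it makes \<open>A n\<close> a
  component and later keeps other components from accumulating at it.\<close>

lemma closed_JG_diff_A: "closed (JG - A n)"
proof -
  have "JG - A n = Jm \<union> (\<Union>k\<in>- {n}. A k)"
  proof (intro set_eqI iffI)
    fix x assume "x \<in> JG - A n"
    thus "x \<in> Jm \<union> (\<Union>k\<in>- {n}. A k)" unfolding JG_eq by auto
  next
    fix x assume "x \<in> Jm \<union> (\<Union>k\<in>- {n}. A k)"
    then consider "x \<in> Jm" | k where "k \<noteq> n" "x \<in> A k" by auto
    thus "x \<in> JG - A n"
    proof cases
      case 1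
      thus ?thesis using A_disjoint_Jm[of n] by (auto simp: JG_eq)
    next
      case 2
      thus ?thesis using A_disjoint[of k n] by (auto simp: JG_eq)
    qed
  qed
  thus ?thesis using closed_Jm_Union_A by simp
qed

lemma A_component: "A n \<in> components JG"
  by (intro clopen_in_components A_nonempty connected_A A_subset_JG closed_JG_diff_A
      compact_imp_closed compact_A)

text \<open>A component meeting \<open>Jm\<close> contains it, and it cannot meet any
  \<open>A n\<close> without being equal to it; so nothing is left to add to
  \<open>Jm\<close>.\<close>

lemma components_JG: "components JG = insert Jm (range A)"
proof -
  have Jm: "C = Jm" if C: "C \<in> components JG" "C \<inter> Jm \<noteq> {}" for C
  proof
    show "Jm \<subseteq> C" using components_maximal[OF C(1) connected_Jm Jm_subset_JG] C(2) by blast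
    have "C \<inter> A n = {}" for n
    proof (rule ccontr)
      assume "C \<inter> A n \<noteq> {}"
      hence "C = A n" using components_eq[OF C(1) A_component] by blast
      thus False using C(2) A_disjoint_Jm by blast
    qed
    thus "C \<subseteq> Jm" using in_components_subset[OF C(1)] unfolding JG_eq by blast
  qed
  show ?thesis
  proof
    show "components JG \<subseteq> insert Jm (range A)"
    proof
      fix C assume C: "C \<in> components JG"
      show "C \<in> insert Jm (range A)"
      proof (cases "C \<inter> Jm = {}")
        case True
        obtain x where "x \<in> C" using in_components_nonempty[OF C] by blast
        then obtain n where "x \<in> A n" using True in_components_subset[OF C] unfolding JG_eq by blast
        hence "C = A n" using components_eq[OF C A_component] \<open>x \<in> C\<close> by blast
        thus ?thesis by blast
      qed (use Jm[OF C] in blast)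
    qed
    obtain x where x: "x \<in> Jm" using Jm_nonempty by blast
    hence "x \<in> JG" using Jm_subset_JG by blast
    hence "x \<in> \<Union> (components JG)" by simp
    then obtain C where "C \<in> components JG" "x \<in> C" by blast
    hence "Jm \<in> components JG" using Jm x by blast
    thus "insert Jm (range A) \<subseteq> components JG" using A_component by auto
  qed
qed

lemma inj_A: "inj A"
proof (rule injI, rule ccontr)
  fix n k assume "A n = A k" "n \<noteq> k"
  thus False using A_disjoint[of n k] A_nonempty[of n] by simp
qed

lemma Jm_neq_A: "Jm \<noteq> A n"
  using A_disjoint_Jm[of n] Jm_nonempty by auto

end

subsection \<open>Transfer to the sphere\<close>

lemma Fin_image_in_components_iff: "Fin ` D \<in> components (Fin ` S) \<longleftrightarrow> D \<in> components S"
proof -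
  have "(\<forall>E. E \<noteq> {} \<and> Fin ` D \<subseteq> E \<and> E \<subseteq> Fin ` S \<and> connected E \<longrightarrow> E = Fin ` D) \<longleftrightarrow>
      (\<forall>E. E \<noteq> {} \<and> D \<subseteq> E \<and> E \<subseteq> S \<and> connected E \<longrightarrow> E = D)" (is "?L \<longleftrightarrow> ?R")
  proof
    assume L: ?L
    show ?R
    proof (intro allI impI)
      fix E assume "E \<noteq> {} \<and> D \<subseteq> E \<and> E \<subseteq> S \<and> connected E"
      hence "Fin ` E = Fin ` D" by (intro L[rule_format]) (auto simp: connected_Fin_image_iff)
      thus "E = D" by (simp add: inj_image_eq_iff[OF inj_Fin])
    qed
  next
    assume R: ?R
    show ?L
    proof (intro allI impI)
      fix E assume E: "E \<noteq> {} \<and> Fin ` D \<subseteq> E \<and> E \<subseteq> Fin ` S \<and> connected E"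
      then obtain E' where E': "E = Fin ` E'" by (auto simp: subset_image_iff)
      have "E' = D"
        by (intro R[rule_format])
           (use E in \<open>auto simp: E' connected_Fin_image_iff inj_image_subset_iff[OF inj_Fin]\<close>)
      thus "E = Fin ` D" by (simp add: E')
    qed
  qed
  thus ?thesis
    unfolding in_components_maximal
    by (simp add: connected_Fin_image_iff inj_image_subset_iff[OF inj_Fin])
qed

lemma components_Fin_image: "components (Fin ` S) = (`) Fin ` components S"
proof
  show "components (Fin ` S) \<subseteq> (`) Fin ` components S"
  proof
    fix C assume C: "C \<in> components (Fin ` S)"
    then obtain D where "C = Fin ` D" using in_components_subset subset_imageE by metis
    thus "C \<in> (`) Fin ` components S" using C Fin_image_in_components_iff by blast
  qed
qed (auto simp: Fin_image_in_components_iff)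

lemma vimage_Fin_image: "Fin -` Fin ` S = S"
  by auto

text \<open>The inside is the union of all bounded complementary components; connectedness places
  \<open>X\<close> in a single one of them.\<close>

lemma surrounded_by_iff:
  assumes "connected X" "X \<noteq> {}"
  shows "X \<preceq>\<^sub>s Y \<longleftrightarrow> X = Y \<or> X \<subseteq> inside Y"
proof -
  have "(\<exists>U\<in>components (- Y). bounded U \<and> X \<subseteq> U) \<longleftrightarrow> X \<subseteq> inside Y"
  proof
    assume "\<exists>U\<in>components (- Y). bounded U \<and> X \<subseteq> U"
    then obtain y where y: "bounded (connected_component_set (- Y) y)" "X \<subseteq> connected_component_set (- Y) y"
      by (auto simp: components_def)
    show "X \<subseteq> inside Y"
    proof
      fix x assume "x \<in> X"
      hence x: "x \<in> connected_component_set (- Y) y" using y(2) by blast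
      hence "connected_component_set (- Y) x = connected_component_set (- Y) y"
        by (metis connected_component_eq)
      moreover have "x \<notin> Y" using x connected_component_subset by blast
      ultimately show "x \<in> inside Y" using y(1) by (simp add: inside_def)
    qed
  next
    assume X: "X \<subseteq> inside Y"
    obtain x where x: "x \<in> X" using assms(2) by blast
    have "X \<subseteq> - Y" using X inside_no_overlap[of Y] by blast
    hence "X \<subseteq> connected_component_set (- Y) x"
      by (intro connected_component_maximal x assms(1))
    moreover have "bounded (connected_component_set (- Y) x)" "x \<in> - Y"
      using X x by (auto simp: inside_def)
    ultimately show "\<exists>U\<in>components (- Y). bounded U \<and> X \<subseteq> U"
      by (auto simp: components_def)
  qed
  thus ?thesis by (simp add: surrounded_by_def)
qed

lemma surrounded_by_antisym:
  assumes "compact X" "connected X" "X \<noteq> {}" "compact Y" "connected Y" "Y \<noteq> {}"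
    and "X \<preceq>\<^sub>s Y" "Y \<preceq>\<^sub>s X"
  shows "X = Y"
  using assms surrounded_by_iff inside_asym by metis

text \<open>The distance to \<open>J\<close> has a positive minimum on the compact rest of the Julia
  set, and every component other than \<open>J\<close> lies in that rest.\<close>

lemma not_components_accumulate_at:
  assumes J: "J \<in> julia_components G" "closed J" and Y: "compact (julia_set G - J)"
  shows "\<not> components_accumulate_at G J"
proof
  assume "components_accumulate_at G J"
  then obtain C where C: "\<And>j. C j \<in> julia_components G" "inj C"
    and lim: "(\<lambda>j. INF z\<in>C j. infdist z J) \<longlonglongrightarrow> 0"
    unfolding components_accumulate_at_def by blast
  let ?Y = "julia_set G - J"
  have CY: "C j \<subseteq> ?Y" "C j \<noteq> {}" if "C j \<noteq> J" for j
    using components_eq[OF C(1)[of j] J(1)] that in_components_subset[OF C(1)[of j]]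
      in_components_nonempty[OF C(1)[of j]] by blast+
  \<comment> \<open>An injective sequence can pass through \<open>J\<close> itself, where the
    infimum is zero, but not at two successive indices.\<close>
  have two: "C j \<noteq> J \<or> C (Suc j) \<noteq> J" for j
    using injD[OF C(2), of j "Suc j"] by auto
  have "?Y \<noteq> {}" using two[of 0] CY by blast
  moreover have "continuous_on ?Y (\<lambda>y. infdist y J)" by (intro continuous_intros)
  ultimately obtain y where y: "y \<in> ?Y" "\<And>z. z \<in> ?Y \<Longrightarrow> infdist y J \<le> infdist z J"
    using continuous_attains_inf[OF Y] by blast
  have "infdist y J > 0"
    using y(1) by (intro infdist_pos_not_in_closed J(2) in_components_nonempty[OF J(1)]) auto
  hence "\<forall>\<^sub>F j in sequentially. (INF z\<in>C j. infdist z J) < infdist y J"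
    by (rule order_tendstoD(2)[OF lim])
  then obtain N where N: "\<And>j. j \<ge> N \<Longrightarrow> (INF z\<in>C j. infdist z J) < infdist y J"
    by (auto simp: eventually_sequentially)
  obtain j where j: "j \<ge> N" "C j \<noteq> J" using two[of N] by (metis le_refl le_SucI)
  have "infdist y J \<le> (INF z\<in>C j. infdist z J)"
    using CY[OF j(2)] y(2) by (intro cINF_greatest) auto
  thus False using N[OF j(1)] by simp
qed

context nested_julia
begin

lemma julia_components_G: "julia_components G = insert (Fin ` Jm) (range (\<lambda>n. Fin ` A n))"
  unfolding julia_G components_Fin_image components_JG by (simp add: image_image)

lemma planar_julia_components_G: "planar_julia_components G = julia_components G"
  unfolding planar_julia_components_def julia_components_G by auto

lemma planar_continuum:
  assumes "C \<in> planar_julia_components G"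
  shows "compact (Fin -` C)" "connected (Fin -` C)" "Fin -` C \<noteq> {}" "C = Fin ` (Fin -` C)"
  using assms compact_A connected_A A_nonempty compact_Jm connected_Jm Jm_nonempty
  unfolding planar_julia_components_G julia_components_G
  by (auto simp: vimage_Fin_image)

lemma planar_cases:
  assumes "C \<in> planar_julia_components G"
  shows "Fin -` C = Jm \<or> (\<exists>n. Fin -` C = A n)"
  using assms unfolding planar_julia_components_G julia_components_G
  by (auto simp only: vimage_Fin_image)

lemma J_min_eq:
  assumes C: "C \<in> planar_julia_components G"
    and le: "\<And>J. J \<in> planar_julia_components G \<Longrightarrow> Fin -` C \<preceq>\<^sub>s Fin -` J"
  shows "J_min G = C"
  unfolding J_min_def
proof (rule the_equality)
  fix C' assume C': "C' \<in> planar_julia_components G \<and> (\<forall>J\<in>planar_julia_components G. Fin -` C' \<preceq>\<^sub>s Fin -` J)"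
  hence "Fin -` C' = Fin -` C"
    using surrounded_by_antisym[OF planar_continuum(1-3) planar_continuum(1-3)] C le by blast
  thus "C' = C" using planar_continuum(4) C C' by metis
qed (use C le in blast)

lemma J_max_eq:
  assumes C: "C \<in> planar_julia_components G"
    and le: "\<And>J. J \<in> planar_julia_components G \<Longrightarrow> Fin -` J \<preceq>\<^sub>s Fin -` C"
  shows "J_max G = C"
  unfolding J_max_def
proof (rule the_equality)
  fix C' assume C': "C' \<in> planar_julia_components G \<and> (\<forall>J\<in>planar_julia_components G. Fin -` J \<preceq>\<^sub>s Fin -` C')"
  hence "Fin -` C' = Fin -` C"
    using surrounded_by_antisym[OF planar_continuum(1-3) planar_continuum(1-3)] C le by blast
  thus "C' = C" using planar_continuum(4) C C' by metis
qed (use C le in blast)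

text \<open>The sets \<open>A n\<close> move monotonically from \<open>A 0 = J\<^sub>0\<close>
  towards \<open>Jm\<close>, so these two are the ends of the order.\<close>

lemma J_min_max_cases:
  "J_min G = Fin ` J\<^sub>0 \<and> J_max G = Fin ` Jm \<or> J_min G = Fin ` Jm \<and> J_max G = Fin ` J\<^sub>0"
proof -
  have "Fin ` A 0 \<in> planar_julia_components G" and mem: "Fin ` Jm \<in> planar_julia_components G"
    unfolding planar_julia_components_G julia_components_G by blast+
  hence mem0: "Fin ` J\<^sub>0 \<in> planar_julia_components G" by (simp only: A_0)
  have A0n: "n = 0 \<or> 0 < n" for n :: nat by auto
  have J0: "J\<^sub>0 \<noteq> {}" using J0_two_points by blast
  note iff = surrounded_by_iff[OF connected_J0 J0] surrounded_by_iff[OF connected_Jm Jm_nonempty]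
    surrounded_by_iff[OF connected_A A_nonempty]
  have refl: "X \<preceq>\<^sub>s X" for X by (simp add: surrounded_by_def)
  from nested_Jm_J0 show ?thesis
  proof
    assume *: "J\<^sub>0 \<subseteq> inside Jm"
    have "J\<^sub>0 \<preceq>\<^sub>s A n" for n
      using A_nested_up[OF *, of 0 n] A0n[of n] unfolding iff by (auto simp only: A_0)
    moreover have "J\<^sub>0 \<preceq>\<^sub>s Jm" "A n \<preceq>\<^sub>s Jm" for n
      using * A_inside_Jm[OF *] unfolding iff by blast+
    ultimately have le: "J\<^sub>0 \<preceq>\<^sub>s Fin -` J" "Fin -` J \<preceq>\<^sub>s Jm" if "J \<in> planar_julia_components G" for J
      using planar_cases[OF that] refl[of Jm] by fastforce+
    have "J_min G = Fin ` J\<^sub>0"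
      by (rule J_min_eq[OF mem0]) (simp only: vimage_Fin_image le)
    moreover have "J_max G = Fin ` Jm"
      by (rule J_max_eq[OF mem]) (simp only: vimage_Fin_image le)
    ultimately show ?thesis by blast
  next
    assume *: "Jm \<subseteq> inside J\<^sub>0"
    have "A n \<preceq>\<^sub>s J\<^sub>0" for n
      using A_nested_down[OF *, of 0 n] A0n[of n] unfolding iff by (auto simp only: A_0)
    moreover have "Jm \<preceq>\<^sub>s J\<^sub>0" "Jm \<preceq>\<^sub>s A n" for n
      using * Jm_inside_A[OF *] unfolding iff by blast+
    ultimately have le: "Fin -` J \<preceq>\<^sub>s J\<^sub>0" "Jm \<preceq>\<^sub>s Fin -` J" if "J \<in> planar_julia_components G" for J
      using planar_cases[OF that] refl[of Jm] by fastforce+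
    have "J_max G = Fin ` J\<^sub>0"
      by (rule J_max_eq[OF mem0]) (simp only: vimage_Fin_image le)
    moreover have "J_min G = Fin ` Jm"
      by (rule J_min_eq[OF mem]) (simp only: vimage_Fin_image le)
    ultimately show ?thesis by blast
  qed
qed

lemma julia_components_eqpoll: "julia_components G \<approx> (UNIV :: nat set)"
proof -
  have "inj (\<lambda>n. Fin ` A n)"
    using inj_A by (auto simp: inj_on_def inj_image_eq_iff[OF inj_Fin])
  hence "infinite (julia_components G)"
    unfolding julia_components_G using finite_imageD[of "\<lambda>n. Fin ` A n" UNIV] by auto
  moreover have "countable (julia_components G)"
    unfolding julia_components_G by simp
  ultimately have "bij_betw (from_nat_into (julia_components G)) UNIV (julia_components G)"
    by (rule bij_betw_from_nat_into[rotated])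
  thus ?thesis using eqpoll_def eqpoll_sym by blast
qed

lemma julia_q: "julia (sphere_poly q) = Fin ` Jm"
  by (simp add: julia_sphere_poly[OF degq] Jm_def)

lemma vimage_Fin_J0: "(sphere_poly q ^^ n) -` (Fin ` J\<^sub>0) = Fin ` A n"
proof (intro set_eqI)
  have "(sphere_poly q ^^ n) Infty = Infty" by (induction n) auto
  thus "x \<in> (sphere_poly q ^^ n) -` (Fin ` J\<^sub>0) \<longleftrightarrow> x \<in> Fin ` A n" for x
    by (cases x) (auto simp: funpow_sphere_poly A_def)
qed

lemma julia_set_G_eq: "julia_set G = Fin ` Jm \<union> (\<Union>n. (sphere_poly q ^^ n) -` (Fin ` J\<^sub>0))"
  unfolding julia_G vimage_Fin_J0 JG_eq by blast

lemma no_accumulation: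
  assumes "J \<in> julia_components G" "J \<noteq> Fin ` Jm"
  shows "\<not> components_accumulate_at G J"
proof -
  obtain n where J: "J = Fin ` A n" using assms by (auto simp: julia_components_G)
  show ?thesis
  proof (rule not_components_accumulate_at[OF assms(1)])
    show "closed J" unfolding J by (intro compact_imp_closed compact_Fin_image compact_A)
    have "julia_set G - J = Fin ` (JG - A n)"
      unfolding J julia_G by (simp add: image_set_diff[OF inj_Fin])
    moreover have "compact (JG - A n)"
      using compact_Int_closed[OF compact_JG closed_JG_diff_A[of n]] by (simp add: Int_Diff Int_absorb1 inf.absorb2)
    ultimately show "compact (julia_set G - J)" by (simp add: compact_Fin_image)
  qed
qed

lemma conclusion:
  "julia_components G \<approx> (UNIV :: nat set) \<and>
    (Fin ` J\<^sub>0 = J_min G \<or> Fin ` J\<^sub>0 = J_max G) \<and>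
    (Fin ` J\<^sub>0 = J_min G \<longrightarrow>
      J_max G = julia (sphere_poly q) \<and>
      julia_set G = J_max G \<union> (\<Union>n::nat. (sphere_poly q ^^ n) -` J_min G) \<and>
      (\<forall>J \<in> julia_components G. J \<noteq> J_max G \<longrightarrow> \<not> components_accumulate_at G J)) \<and>
    (Fin ` J\<^sub>0 = J_max G \<longrightarrow>
      J_min G = julia (sphere_poly q) \<and>
      julia_set G = J_min G \<union> (\<Union>n::nat. (sphere_poly q ^^ n) -` J_max G) \<and>
      (\<forall>J \<in> julia_components G. J \<noteq> J_min G \<longrightarrow> \<not> components_accumulate_at G J))"
proof -
  \<comment> \<open>In either order this falsifies the premise of one of the two final
    implications.\<close>
  have ne: "Fin ` J\<^sub>0 \<noteq> Fin ` Jm"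
    using Jm_neq_A[of 0] by (auto simp: inj_image_eq_iff[OF inj_Fin] A_0)
  from J_min_max_cases show ?thesis
  proof
    assume "J_min G = Fin ` J\<^sub>0 \<and> J_max G = Fin ` Jm"
    thus ?thesis
      using ne julia_components_eqpoll julia_q julia_set_G_eq no_accumulation by simp
  next
    assume "J_min G = Fin ` Jm \<and> J_max G = Fin ` J\<^sub>0"
    thus ?thesis
      using ne julia_components_eqpoll julia_q julia_set_G_eq no_accumulation by simp
  qed
qed

end

section \<open>Critical values and passage from the given generators to polynomials\<close>

lemma critical_values_sphere_poly:
  assumes "poly (pderiv f) z = 0"
  shows "Fin (poly f z) \<in> critical_values (sphere_poly f)"
proof -
  have "deriv (poly f) z = 0" using assms DERIV_imp_deriv[OF poly_DERIV] by metis
  hence "critical_point (sphere_poly f) (Fin z)" by (simp add: critical_at_finite_def)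
  hence "sphere_poly f (Fin z) \<in> critical_values (sphere_poly f)"
    unfolding critical_values_def by blast
  thus ?thesis by simp
qed

theorem theorem2p26:
  fixes m :: nat
    and h :: "nat \<Rightarrow> riemann_sphere \<Rightarrow> riemann_sphere"
    and G :: "(riemann_sphere \<Rightarrow> riemann_sphere) set"
    and J\<^sub>0 :: "riemann_sphere set"
  assumes m: "m \<ge> 3"
    and h: "\<And>j. j \<in> {1..m} \<Longrightarrow> polynomial_map (h j)"
    and G: "G = semigroup_generated (h ` {1..m})"
    and dis: "G \<in> pcb_dis_semigroups"
    and J\<^sub>0: "J\<^sub>0 \<in> julia_components G"
    and sub: "(\<Union>j\<in>{1..m-1}. julia (h j)) \<subseteq> J\<^sub>0"
    and meet: "\<And>j. j \<in> {1..m-1} \<Longrightarrow> (h j -` julia (h m)) \<inter> J\<^sub>0 \<noteq> {}"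
  shows "julia_components G \<approx> (UNIV :: nat set) \<and>
    (J\<^sub>0 = J_min G \<or> J\<^sub>0 = J_max G) \<and>
    (J\<^sub>0 = J_min G \<longrightarrow>
      J_max G = julia (h m) \<and>
      julia_set G = J_max G \<union> (\<Union>n::nat. (h m ^^ n) -` J_min G) \<and>
      (\<forall>J \<in> julia_components G. J \<noteq> J_max G \<longrightarrow> \<not> components_accumulate_at G J)) \<and>
    (J\<^sub>0 = J_max G \<longrightarrow>
      J_min G = julia (h m) \<and>
      julia_set G = J_min G \<union> (\<Union>n::nat. (h m ^^ n) -` J_max G) \<and>
      (\<forall>J \<in> julia_components G. J \<noteq> J_min G \<longrightarrow> \<not> components_accumulate_at G J))"
proof -
  have pcb: "G \<in> pcb_semigroups" and disc: "\<not> connected (julia_set G)"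
    using dis by (auto simp: pcb_dis_semigroups_def)
  have "\<forall>j\<in>{1..m}. \<exists>p. degree p \<ge> 2 \<and> h j = sphere_poly p"
  proof
    fix j assume "j \<in> {1..m}"
    hence "h j \<in> G" unfolding G by (intro semigroup_generated.gen imageI)
    thus "\<exists>p. degree p \<ge> 2 \<and> h j = sphere_poly p"
      using pcb by (auto simp: pcb_semigroups_def)
  qed
  then obtain p where p: "\<And>j. j \<in> {1..m} \<Longrightarrow> degree (p j) \<ge> 2"
    "\<And>j. j \<in> {1..m} \<Longrightarrow> h j = sphere_poly (p j)" by metis
  define P where "P = p ` {1..m-1}"
  define q where "q = p m"
  have "{1..m} = insert m {1..m-1}" using m by auto
  hence "sphere_poly ` insert q P = (\<lambda>j. sphere_poly (p j)) ` {1..m}"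
    by (simp add: P_def q_def image_image)
  also have "\<dots> = h ` {1..m}" using p(2) by (intro image_cong) auto
  finally have GP: "G = semigroup_generated (sphere_poly ` insert q P)" using G by simp
  have hm: "h m = sphere_poly q" using p(2)[of m] m by (simp add: q_def)
  have degP: "degree r \<ge> 2" if "r \<in> insert q P" for r
    using that p(1) m by (auto simp: P_def q_def)
  have finP: "finite (insert q P)" by (simp add: P_def)
  have JG: "julia_set G = Fin ` (Fin -` julia_set G)"
    using julia_set_subset_range_Fin(1)[OF finP degP] GP by auto
  have J0: "J\<^sub>0 = Fin ` (Fin -` J\<^sub>0)"
    using in_components_subset[OF J\<^sub>0] JG by auto
  obtain B where B: "\<And>z. z \<in> planar_postcritical_set G \<Longrightarrow> norm z \<le> B"
    using pcb by (auto simp: pcb_semigroups_def bounded_iff)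
  interpret nested_julia P q "Fin -` J\<^sub>0" B G "Fin -` julia_set G"
  proof
    show "G = semigroup_generated (sphere_poly ` insert q P)" by (rule GP)
    show "finite P" "P \<noteq> {}" using m by (auto simp: P_def)
    show "degree r \<ge> 2" if "r \<in> insert q P" for r using degP that .
    show "norm (poly f z) \<le> B" if f: "sphere_poly f \<in> G" and z: "poly (pderiv f) z = 0" for f z
    proof (rule B)
      have "Fin (poly f z) \<in> (\<Union>g\<in>G. critical_values g)"
        using f critical_values_sphere_poly[OF z] by blast
      hence "Fin (poly f z) \<in> postcritical_set G"
        unfolding postcritical_set_def by (rule subsetD[OF closure_subset])
      thus "poly f z \<in> planar_postcritical_set G" by (simp add: planar_postcritical_set_def)
    qed
    show "\<not> connected (Fin -` julia_set G)"
    proof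
      assume "connected (Fin -` julia_set G)"
      hence "connected (Fin ` (Fin -` julia_set G))" by (simp only: connected_Fin_image_iff)
      hence "connected (julia_set G)" by (subst JG)
      thus False using disc by simp
    qed
    show "Fin -` J\<^sub>0 \<in> components (Fin -` julia_set G)"
    proof (rule Fin_image_in_components_iff[THEN iffD1])
      show "Fin ` (Fin -` J\<^sub>0) \<in> components (Fin ` (Fin -` julia_set G))"
        by (subst J0[symmetric], subst JG[symmetric], rule J\<^sub>0)
    qed
    fix r assume "r \<in> P"
    then obtain j where j: "j \<in> {1..m-1}" "r = p j" by (auto simp: P_def)
    hence hj: "h j = sphere_poly r" using p(2)[of j] by auto
    have "Fin ` frontier (filled_julia r) \<subseteq> J\<^sub>0"
    proof -
      have "julia (h j) \<subseteq> J\<^sub>0" using sub j(1) by (rule UN_subset_iff[THEN iffD1, THEN bspec])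
      moreover have "julia (h j) = Fin ` frontier (filled_julia r)"
        unfolding hj using \<open>r \<in> P\<close> by (intro julia_sphere_poly degP) simp
      ultimately show ?thesis by simp
    qed
    thus "frontier (filled_julia r) \<subseteq> Fin -` J\<^sub>0" by auto
    obtain x where x: "h j x \<in> julia (h m)" "x \<in> J\<^sub>0" using meet[OF j(1)] by blast
    have "x \<in> Fin ` (Fin -` J\<^sub>0)" using x(2) by (subst J0[symmetric])
    then obtain w where w: "x = Fin w" by blast
    have "Fin (poly r w) \<in> julia (sphere_poly q)" using x(1) by (simp add: hj hm w)
    hence "poly r w \<in> frontier (filled_julia q)"
      unfolding julia_sphere_poly[OF degP[OF insertI1]] by auto
    thus "poly r -` frontier (filled_julia q) \<inter> Fin -` J\<^sub>0 \<noteq> {}" using x(2) unfolding w by auto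
  qed (rule refl)
  show ?thesis using conclusion unfolding J0[symmetric] hm[symmetric] .
qed

end
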